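(* Let $\rho_1,\dots,\rho_N$ be pairwise orthogonal density operators on $\mathbb C^2\otimes\mathbb C^n$, shared by Alice (holding the qubit $\mathbb C^2$) and Bob (holding $\mathbb C^n$). Consider LOCC protocols in which Alice goes first. Then there is such a protocol that perfectly discriminates $\rho_1,\dots,\rho_N$ if and only if there exists an orthonormal basis $\{|0\rangle,|1\rangle\}$ of Alice's space $\mathbb C^2$ such that for every $k$ and every $|\psi_k\rangle\in\mathrm{Supp}(\rho_k)$, writing $$|\psi_k\rangle=|0\rangle_A|\psi_0^{(k)}\rangle_B+|1\rangle_A|\psi_1^{(k)}\rangle_B,$$ one has $\langle\psi_0^{(k)}|\psi_0^{(l)}\rangle=\langle\psi_1^{(k)}|\psi_1^{(l)}\rangle=0$ for all $k\neq l$ and all choices $|\psi_k\rangle\in\mathrm{Supp}(\rho_k)$, $|\psi_l\rangle\in\mathrm{Supp}(\rho_l)$.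
   Context: $\mathrm{Supp}(\rho)$ is the span of the eigenvectors of $\rho$ with positive eigenvalues. Density operators are orthogonal if $\mathrm{tr}(\rho_k\rho_l)=0$. A set of states is perfectly discriminated by an LOCC protocol (finitely many rounds, in each of which one party performs a local measurement and broadcasts the outcome) if, whichever state of the set is given, the protocol outputs its correct index with probability 1. A measurement operator $M$ is trivial if $M^\dagger M$ is proportional to the identity; a measurement is non-trivial if at least one of its operators is not trivial. "Alice goes first" means Alice is the party performing the first non-trivial measurement of the protocol. *)

theory Defs
  imports "Jordan_Normal_Form.Matrix"
begin

(* Conventions: Alice's space C^2, Bob's space C^n; the joint space C^2 (x) C^n is
   identified with C^(2*n), basis vector |a>|b> having index a*n + b (a<2, b<n). *)

definition adj :: "complex mat \<Rightarrow> complex mat" where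
  "adj A = mat (dim_col A) (dim_row A) (\<lambda>(i,j). cnj (A $$ (j,i)))"

definition tr :: "complex mat \<Rightarrow> complex" where
  "tr A = (\<Sum>i<dim_row A. A $$ (i,i))"

definition cinner :: "complex vec \<Rightarrow> complex vec \<Rightarrow> complex" where
  "cinner u v = (\<Sum>i<dim_vec u. cnj (u $ i) * v $ i)"

definition kron :: "complex mat \<Rightarrow> complex mat \<Rightarrow> complex mat" where
  "kron A B = mat (dim_row A * dim_row B) (dim_col A * dim_col B)
     (\<lambda>(i,j). A $$ (i div dim_row B, j div dim_col B) * B $$ (i mod dim_row B, j mod dim_col B))"

definition density_op :: "nat \<Rightarrow> complex mat \<Rightarrow> bool" where
  "density_op d \<rho> \<longleftrightarrow> \<rho> \<in> carrier_mat d d \<and> adj \<rho> = \<rho> \<and>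
     (\<forall>v \<in> carrier_vec d. Re (cinner v (\<rho> *\<^sub>v v)) \<ge> 0) \<and> tr \<rho> = 1"

definition vsum :: "nat \<Rightarrow> complex vec list \<Rightarrow> complex vec" where
  "vsum d vs = foldr (+) vs (0\<^sub>v d)"

definition msum :: "nat \<Rightarrow> complex mat list \<Rightarrow> complex mat" where
  "msum d Ms = foldr (+) Ms (0\<^sub>m d d)"

definition Supp :: "complex mat \<Rightarrow> complex vec set" where
  "Supp \<rho> = {vsum (dim_row \<rho>) (map (\<lambda>(c,w). c \<cdot>\<^sub>v w) cws) | cws.
      \<forall>(c,w) \<in> set cws. w \<in> carrier_vec (dim_row \<rho>) \<and>
         (\<exists>r::real. r > 0 \<and> \<rho> *\<^sub>v w = complex_of_real r \<cdot>\<^sub>v w)}"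

datatype party = Alice | Bob

(* An LOCC protocol with finitely many rounds: a finite tree.  At a node one party
   performs a local measurement with operators M_1..M_m (one per outcome); the outcome
   is broadcast and the protocol continues with the subprotocol attached to it.
   A leaf outputs an index. *)
datatype protocol = Output nat | Measure party "(complex mat \<times> protocol) list"

definition local_dim :: "nat \<Rightarrow> party \<Rightarrow> nat" where
  "local_dim n p = (case p of Alice \<Rightarrow> 2 | Bob \<Rightarrow> n)"

definition lift :: "nat \<Rightarrow> party \<Rightarrow> complex mat \<Rightarrow> complex mat" where
  "lift n p M = (case p of Alice \<Rightarrow> kron M (1\<^sub>m n) | Bob \<Rightarrow> kron (1\<^sub>m 2) M)"

fun wf_protocol :: "nat \<Rightarrow> protocol \<Rightarrow> bool" where
  "wf_protocol n (Output k) = True"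
| "wf_protocol n (Measure p bs) \<longleftrightarrow> bs \<noteq> [] \<and>
     (\<forall>b \<in> set bs. fst b \<in> carrier_mat (local_dim n p) (local_dim n p) \<and> wf_protocol n (snd b)) \<and>
     msum (local_dim n p) (map (\<lambda>b. adj (fst b) * fst b) bs) = 1\<^sub>m (local_dim n p)"

definition trivial_op :: "complex mat \<Rightarrow> bool" where
  "trivial_op M \<longleftrightarrow> (\<exists>c. adj M * M = c \<cdot>\<^sub>m 1\<^sub>m (dim_col M))"

fun alice_first :: "protocol \<Rightarrow> bool" where
  "alice_first (Output k) = True"
| "alice_first (Measure p bs) =
     (if (\<exists>b \<in> set bs. \<not> trivial_op (fst b)) then p = Alice
      else (\<forall>b \<in> set bs. alice_first (snd b)))"

(* probability that the protocol, run on (unnormalised) state rho, outputs k *)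
fun prob_out :: "nat \<Rightarrow> protocol \<Rightarrow> complex mat \<Rightarrow> nat \<Rightarrow> real" where
  "prob_out n (Output m) \<rho> k = (if m = k then Re (tr \<rho>) else 0)"
| "prob_out n (Measure p bs) \<rho> k =
     sum_list (map (\<lambda>b. prob_out n (snd b) (lift n p (fst b) * \<rho> * adj (lift n p (fst b))) k) bs)"

definition perfectly_discriminates :: "nat \<Rightarrow> protocol \<Rightarrow> nat \<Rightarrow> (nat \<Rightarrow> complex mat) \<Rightarrow> bool" where
  "perfectly_discriminates n P N \<rho> \<longleftrightarrow> (\<forall>k \<in> {1..N}. prob_out n P (\<rho> k) k = 1)"

(* component of a joint vector psi along Alice's vector e:  (<e| (x) I) psi *)
definition bob_part :: "nat \<Rightarrow> complex vec \<Rightarrow> complex vec \<Rightarrow> complex vec" where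
  "bob_part n e \<psi> = vec n (\<lambda>b. \<Sum>a<2. cnj (e $ a) * \<psi> $ (a * n + b))"

end

theory Submission
  imports Defs "Jordan_Normal_Form.Schur_Decomposition"
begin

text \<open>
  A protocol discriminates the states perfectly iff every leaf annihilates the supports of all
  states other than the one it announces. Since the operators of a measurement satisfy
  \<open>\<Sum> M\<^sup>\<dagger>M = I\<close>, orthogonality of the supports propagates from the leaves up to every node.
  At Alice's first non-trivial measurement, some \<open>M\<^sup>\<dagger>M\<close> has two distinct eigenvalues, and
  orthogonality before and after the outcome \<open>M\<close> forces both components with respect to its
  eigenbasis to be orthogonal; the preceding trivial measurements are multiples of unitaries and
  only rotate the basis. Conversely, Alice measures in the given basis, after which Bob's
  conditional supports are pairwise orthogonal and he measures the projectors onto them.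
\<close>

text \<open>Success probabilities are quadratic in the state, whereas orthogonality of Bob's
  components is a statement about vectors. Positivity links the two:
  \<open>tr (K * \<rho> * adj K)\<close> vanishes only if \<open>K\<close> annihilates the range of
  \<open>\<rho>\<close>, and that range is the support. From there on a state enters only through
  its set of support vectors. The delicate point of the necessity direction is that a trivial
  operator may be zero. Every vector is 0 after such an outcome, so its subprotocol says nothing
  about the states. The descent must therefore choose an outcome with \<open>adj M * M\<close> a
  nonzero multiple of the identity, and one such branch suffices. The sets met on the way are images
  under the operators already applied, so the induction runs over arbitrary families of sets of
  vectors instead of supports. A path may also end at a leaf without any non-trivial measurement;
  there at most one set of the family contains a nonzero vector, and every basis will do.\<close>

lemma adj_carrier [simp, intro]: "A \<in> carrier_mat m n \<Longrightarrow> adj A \<in> carrier_mat n m"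
  by (simp add: adj_def)

lemma dim_adj [simp]: "dim_row (adj A) = dim_col A" "dim_col (adj A) = dim_row A"
  by (simp_all add: adj_def)

lemma index_adj [simp]:
  "i < dim_col A \<Longrightarrow> j < dim_row A \<Longrightarrow> adj A $$ (i, j) = cnj (A $$ (j, i))"
  by (simp add: adj_def)

lemma adj_adj [simp]: "adj (adj A) = A"
  by (rule eq_matI) auto

lemma adj_one [simp]: "adj (1\<^sub>m n) = 1\<^sub>m n"
  by (rule eq_matI) auto

lemma adj_mult:
  assumes "A \<in> carrier_mat a b" "B \<in> carrier_mat b c"
  shows "adj (A * B) = adj B * adj A"
  using assms by (intro eq_matI) (auto simp: scalar_prod_def mult.commute)

lemma adj_add:
  assumes "A \<in> carrier_mat a b" "B \<in> carrier_mat a b"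
  shows "adj (A + B) = adj A + adj B"
  using assms by (intro eq_matI) auto

lemma adj_mult_vec_carrier [simp, intro]: "A \<in> carrier_mat m n \<Longrightarrow> adj A *\<^sub>v u \<in> carrier_vec n"
  by (auto simp: carrier_dim_vec)

section \<open>The sesquilinear inner product\<close>

lemma cinner_add_right:
  assumes "u \<in> carrier_vec d" "v \<in> carrier_vec d" "w \<in> carrier_vec d"
  shows "cinner u (v + w) = cinner u v + cinner u w"
  using assms by (simp add: cinner_def sum.distrib algebra_simps)

lemma cinner_add_left:
  assumes "u \<in> carrier_vec d" "v \<in> carrier_vec d" "w \<in> carrier_vec d"
  shows "cinner (u + v) w = cinner u w + cinner v w"
  using assms by (simp add: cinner_def sum.distrib algebra_simps)

lemma cinner_smult_right:
  assumes "u \<in> carrier_vec d" "v \<in> carrier_vec d"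
  shows "cinner u (c \<cdot>\<^sub>v v) = c * cinner u v"
  using assms by (simp add: cinner_def sum_distrib_left algebra_simps)

lemma cinner_smult_left:
  assumes "u \<in> carrier_vec d" "v \<in> carrier_vec d"
  shows "cinner (c \<cdot>\<^sub>v u) v = cnj c * cinner u v"
  using assms by (simp add: cinner_def sum_distrib_left algebra_simps)

lemma cinner_zero_left: "v \<in> carrier_vec d \<Longrightarrow> cinner (0\<^sub>v d) v = 0"
  by (simp add: cinner_def)

lemma cinner_zero_right: "v \<in> carrier_vec d \<Longrightarrow> cinner v (0\<^sub>v d) = 0"
  by (simp add: cinner_def)

lemma cinner_commute:
  assumes "u \<in> carrier_vec d" "v \<in> carrier_vec d"
  shows "cinner u v = cnj (cinner v u)"
  using assms by (simp add: cinner_def mult.commute)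

lemma cinner_self: "cinner v v = of_real (\<Sum>i<dim_vec v. (cmod (v $ i))\<^sup>2)"
  by (simp add: cinner_def complex_norm_square mult.commute del: of_real_power)

lemma cinner_self_eq_0:
  assumes "v \<in> carrier_vec d"
  shows "cinner v v = 0 \<longleftrightarrow> v = 0\<^sub>v d"
proof
  assume "cinner v v = 0"
  then have "(\<Sum>i<dim_vec v. (cmod (v $ i))\<^sup>2) = 0"
    unfolding cinner_self by (metis of_real_eq_0_iff)
  then have "\<forall>i<dim_vec v. v $ i = 0"
    by (subst (asm) sum_nonneg_eq_0_iff) auto
  then show "v = 0\<^sub>v d" using assms by (intro eq_vecI) auto
qed (simp add: cinner_def)

lemma cinner_adj:
  assumes A: "A \<in> carrier_mat a b" and u: "u \<in> carrier_vec a" and v: "v \<in> carrier_vec b"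
  shows "cinner u (A *\<^sub>v v) = cinner (adj A *\<^sub>v u) v"
proof -
  have "cinner u (A *\<^sub>v v) = (\<Sum>i<a. \<Sum>j<b. cnj (u $ i) * (A $$ (i, j) * v $ j))"
    using assms by (auto simp: cinner_def scalar_prod_def sum_distrib_left atLeast0LessThan
        intro!: sum.cong)
  also have "\<dots> = (\<Sum>j<b. \<Sum>i<a. cnj (u $ i) * (A $$ (i, j) * v $ j))"
    by (rule sum.swap)
  also have "\<dots> = cinner (adj A *\<^sub>v u) v"
    using assms by (auto simp: cinner_def scalar_prod_def sum_distrib_right atLeast0LessThan
        intro!: sum.cong)
  finally show ?thesis .
qed

lemma cinner_adj_left:
  assumes A: "A \<in> carrier_mat a b" and u: "u \<in> carrier_vec b" and v: "v \<in> carrier_vec a"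
  shows "cinner (A *\<^sub>v u) v = cinner u (adj A *\<^sub>v v)"
  using cinner_adj[of "adj A" b a u v] assms by simp

text \<open>Lets matrix identities be checked through the action on vectors, which keeps
  \<open>div\<close> and \<open>mod\<close> of Kronecker entries out of most later proofs.\<close>

lemma eq_mat_by_mult_vec:
  fixes A B :: "complex mat"
  assumes A: "A \<in> carrier_mat a b" and B: "B \<in> carrier_mat a b"
    and eq: "\<And>v. v \<in> carrier_vec b \<Longrightarrow> A *\<^sub>v v = B *\<^sub>v v"
  shows "A = B"
proof (rule eq_matI)
  fix i j assume ij: "i < dim_row B" "j < dim_col B"
  have "(A *\<^sub>v unit_vec b j) $ i = (B *\<^sub>v unit_vec b j) $ i" using eq by simp
  then show "A $$ (i, j) = B $$ (i, j)" using A B ij by simp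
qed (use A B in auto)

lemma mult_mat_zero_vec: "(A :: complex mat) \<in> carrier_mat a b \<Longrightarrow> A *\<^sub>v 0\<^sub>v b = 0\<^sub>v a"
  by (intro eq_vecI) auto

lemma smult_zero_vec_eq [simp]: "c \<cdot>\<^sub>v 0\<^sub>v d = (0\<^sub>v d :: complex vec)"
  by (rule eq_vecI) auto

lemma exists_normalised_multiple:
  assumes v: "v \<in> carrier_vec d" "v \<noteq> 0\<^sub>v d"
  shows "\<exists>c. c \<noteq> 0 \<and> cinner (c \<cdot>\<^sub>v v) (c \<cdot>\<^sub>v v) = 1"
proof -
  define s where "s = (\<Sum>i<dim_vec v. (cmod (v $ i))\<^sup>2)"
  have s: "cinner v v = of_real s" by (simp add: cinner_self s_def)
  have "s \<ge> 0" unfolding s_def by (simp add: sum_nonneg)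
  moreover have "s \<noteq> 0" using cinner_self_eq_0[OF v(1)] v(2) s by auto
  ultimately have "s > 0" by simp
  define c where "c = complex_of_real (1 / sqrt s)"
  have "cinner (c \<cdot>\<^sub>v v) (c \<cdot>\<^sub>v v) = cnj c * (c * cinner v v)"
    using v by (subst cinner_smult_left[where d = d], simp, simp,
        subst cinner_smult_right[where d = d]) auto
  also have "\<dots> = of_real ((1 / sqrt s) * (1 / sqrt s) * s)"
    unfolding c_def s complex_cnj_complex_of_real of_real_mult[symmetric] by (simp only: mult.assoc)
  also have "(1 / sqrt s) * (1 / sqrt s) * s = 1" using \<open>s > 0\<close> by simp
  finally have "cinner (c \<cdot>\<^sub>v v) (c \<cdot>\<^sub>v v) = 1" by simp
  then show ?thesis using \<open>s > 0\<close> by (intro exI[of _ c]) (auto simp: c_def)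
qed

section \<open>Hermitian matrices\<close>

lemma hermitian_eigenvalue_real:
  assumes A: "A \<in> carrier_mat d d" "adj A = A" and w: "w \<in> carrier_vec d" "w \<noteq> 0\<^sub>v d"
    and ev: "A *\<^sub>v w = \<mu> \<cdot>\<^sub>v w"
  shows "cnj \<mu> = \<mu>"
proof -
  have "\<mu> * cinner w w = cinner w (A *\<^sub>v w)" using w by (simp add: ev cinner_smult_right)
  also have "\<dots> = cnj \<mu> * cinner w w"
    using cinner_adj[OF A(1) w(1) w(1)] A w by (simp add: ev cinner_smult_left)
  finally show ?thesis using cinner_self_eq_0[OF w(1)] w(2) by auto
qed

lemma hermitian_eigenvectors_orthogonal:
  assumes A: "A \<in> carrier_mat d d" "adj A = A"
    and v: "v \<in> carrier_vec d" and w: "w \<in> carrier_vec d"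
    and ev: "A *\<^sub>v v = \<mu> \<cdot>\<^sub>v v" "A *\<^sub>v w = \<nu> \<cdot>\<^sub>v w" and ne: "\<mu> \<noteq> \<nu>"
  shows "cinner v w = 0"
proof (cases "v = 0\<^sub>v d")
  case False
  have "\<nu> * cinner v w = cinner v (A *\<^sub>v w)" using v w by (simp add: ev cinner_smult_right)
  also have "\<dots> = \<mu> * cinner v w"
    using cinner_adj[OF A(1) v w] A v w hermitian_eigenvalue_real[OF A v False ev(1)]
    by (simp add: ev cinner_smult_left)
  finally show ?thesis using ne by simp
qed (use w in \<open>simp add: cinner_zero_left\<close>)

inductive_set eig_span :: "nat \<Rightarrow> complex mat \<Rightarrow> complex vec set" for d A where
  zero: "0\<^sub>v d \<in> eig_span d A"
| add: "v \<in> eig_span d A \<Longrightarrow> w \<in> carrier_vec d \<Longrightarrow> A *\<^sub>v w = \<mu> \<cdot>\<^sub>v w \<Longrightarrow> v + w \<in> eig_span d A"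

lemma eig_span_carrier: "v \<in> eig_span d A \<Longrightarrow> v \<in> carrier_vec d"
  by (induction rule: eig_span.induct) auto

text \<open>On an eigenvector with eigenvalue \<nu> different from \<mu>, the map A - \<mu> is
  multiplication by \<nu> - \<mu> and can be inverted. Such summands go into its image; those with
  eigenvalue \<mu> are collected in \<open>u'\<close>.\<close>

lemma eig_span_decompose:
  assumes A: "A \<in> carrier_mat d d" and u: "u \<in> eig_span d A"
  shows "\<exists>v u'. v \<in> eig_span d A \<and> u' \<in> carrier_vec d \<and> A *\<^sub>v u' = \<mu> \<cdot>\<^sub>v u' \<and>
    u = (A *\<^sub>v v - \<mu> \<cdot>\<^sub>v v) + u'"
  using u
proof (induction rule: eig_span.induct)
  case zero
  show ?case using A by (intro exI[of _ "0\<^sub>v d"]) (auto intro: eig_span.zero)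
next
  case (add u w \<nu>)
  then obtain v u' where IH: "v \<in> eig_span d A" "u' \<in> carrier_vec d" "A *\<^sub>v u' = \<mu> \<cdot>\<^sub>v u'"
    "u = (A *\<^sub>v v - \<mu> \<cdot>\<^sub>v v) + u'" by blast
  note v = eig_span_carrier[OF IH(1)]
  show ?case
  proof (cases "\<nu> = \<mu>")
    case True
    have "A *\<^sub>v (u' + w) = \<mu> \<cdot>\<^sub>v (u' + w)"
      using A IH add True by (simp add: mult_add_distrib_mat_vec smult_add_distrib_vec)
    moreover have "u + w = (A *\<^sub>v v - \<mu> \<cdot>\<^sub>v v) + (u' + w)"
      unfolding IH(4) using A IH add v by (intro eq_vecI) auto
    ultimately show ?thesis using IH add by (intro exI[of _ v] exI[of _ "u' + w"]) auto
  next
    case False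
    define x where "x = (1 / (\<nu> - \<mu>)) \<cdot>\<^sub>v w"
    have x: "x \<in> carrier_vec d" using add by (simp add: x_def)
    have Ax: "A *\<^sub>v x = \<nu> \<cdot>\<^sub>v x"
      using A add by (simp add: x_def mult_mat_vec smult_smult_assoc mult.commute)
    have wx: "w = (\<nu> - \<mu>) \<cdot>\<^sub>v x" using False add by (simp add: x_def smult_smult_assoc)
    have Avx: "A *\<^sub>v (v + x) = A *\<^sub>v v + \<nu> \<cdot>\<^sub>v x"
      using A v x by (simp add: mult_add_distrib_mat_vec Ax)
    have "u + w = (A *\<^sub>v (v + x) - \<mu> \<cdot>\<^sub>v (v + x)) + u'"
      unfolding IH(4) Avx wx using A IH(2) v x
      by (intro eq_vecI) (auto simp del: index_mult_mat_vec simp: algebra_simps)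
    moreover have "v + x \<in> eig_span d A" using IH x Ax eig_span.add by blast
    ultimately show ?thesis using IH by blast
  qed
qed

text \<open>A Hermitian matrix has no Jordan chains. After subtracting a preimage,
  \<open>x = v - v'\<close> satisfies (A - \<mu>) x = u with u in the kernel of A - \<mu>;
  self-adjointness makes u orthogonal to the image of A - \<mu>, hence to itself.\<close>

lemma hermitian_eig_span_lift:
  assumes A: "A \<in> carrier_mat d d" "adj A = A" and v: "v \<in> carrier_vec d"
    and span: "A *\<^sub>v v - \<mu> \<cdot>\<^sub>v v \<in> eig_span d A"
  shows "v \<in> eig_span d A"
proof -
  obtain v' u where v': "v' \<in> eig_span d A" and u: "u \<in> carrier_vec d" "A *\<^sub>v u = \<mu> \<cdot>\<^sub>v u"
    and eq: "A *\<^sub>v v - \<mu> \<cdot>\<^sub>v v = (A *\<^sub>v v' - \<mu> \<cdot>\<^sub>v v') + u"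
    using eig_span_decompose[OF A(1) span] by blast
  note v'c = eig_span_carrier[OF v']
  define x where "x = v - v'"
  have x: "x \<in> carrier_vec d" using v v'c by (simp add: x_def)
  have Ax': "A *\<^sub>v x = A *\<^sub>v v - A *\<^sub>v v'"
    using A v v'c by (simp add: x_def mult_minus_distrib_mat_vec)
  have Ax: "A *\<^sub>v x = \<mu> \<cdot>\<^sub>v x + u"
  proof (rule eq_vecI)
    fix i assume i: "i < dim_vec (\<mu> \<cdot>\<^sub>v x + u)"
    have "(A *\<^sub>v v - \<mu> \<cdot>\<^sub>v v) $ i = ((A *\<^sub>v v' - \<mu> \<cdot>\<^sub>v v') + u) $ i" by (simp only: eq)
    then show "(A *\<^sub>v x) $ i = (\<mu> \<cdot>\<^sub>v x + u) $ i"
      unfolding Ax' using i A v v'c u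
      by (simp add: x_def algebra_simps del: index_mult_mat_vec)
  qed (use A x u in simp)
  \<comment> \<open>Moving A - \<mu> to the other side of the inner product needs a real \<mu>,
    which is known once u is a nonzero eigenvector; hence the argument by contradiction.\<close>
  have "u = 0\<^sub>v d"
  proof (rule ccontr)
    assume ne: "u \<noteq> 0\<^sub>v d"
    have "\<mu> * cinner u x + cinner u u = cinner u (A *\<^sub>v x)"
      using u x by (simp add: Ax cinner_add_right cinner_smult_right)
    also have "\<dots> = \<mu> * cinner u x"
      using cinner_adj[OF A(1) u(1) x] A u x hermitian_eigenvalue_real[OF A u(1) ne u(2)]
      by (simp add: cinner_smult_left)
    finally show False using cinner_self_eq_0[OF u(1)] ne by simp
  qed
  then have "A *\<^sub>v x = \<mu> \<cdot>\<^sub>v x" using Ax x by simp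
  then have "v' + x \<in> eig_span d A" using v' x eig_span.add by blast
  moreover have "v' + x = v" using v v'c by (auto simp: x_def)
  ultimately show ?thesis by simp
qed

text \<open>A Schur triangular form gives a flag of invariant subspaces, spanned by the leading
  columns of \<open>P\<close>. Climbing the flag, each A - \<mu> with \<mu> a diagonal entry of
  \<open>B\<close> leads one step down, and \<open>hermitian_eig_span_lift\<close> leads back
  up.\<close>

theorem hermitian_eig_span:
  assumes A: "A \<in> carrier_mat d d" "adj A = A" and v: "v \<in> carrier_vec d"
  shows "v \<in> eig_span d A"
proof -
  obtain es where "char_poly A = (\<Prod>a\<leftarrow>es. [:- a, 1:])"
    using char_poly_factorized[OF A(1)] by blast
  from schur_decomposition_exists[OF A(1) this] obtain B where
    B: "B \<in> carrier_mat d d" "upper_triangular B" and "similar_mat A B" by blast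
  then obtain P Q where "similar_mat_wit A B P Q" unfolding similar_mat_def by blast
  from similar_mat_witD2[OF A(1) this] have P: "P \<in> carrier_mat d d" and Q: "Q \<in> carrier_mat d d"
    and PQ: "P * Q = 1\<^sub>m d" and QP: "Q * P = 1\<^sub>m d" and APBQ: "A = P * B * Q" by auto
  have AP: "A * P = P * B"
  proof -
    have "A * P = P * B * (Q * P)" unfolding APBQ using P Q B by (simp add: assoc_mult_mat[of _ d d _ d _ d])
    then show ?thesis using P B QP by simp
  qed
  have AP': "A *\<^sub>v (P *\<^sub>v c) = P *\<^sub>v (B *\<^sub>v c)" if "c \<in> carrier_vec d" for c
    using that AP A(1) P B by (metis assoc_mult_mat_vec)
  \<comment> \<open>An upper triangular \<open>B - B\<^sub>j\<^sub>j\<close> maps vectors supported on the first \<open>j + 1\<close>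
     coordinates to vectors supported on the first \<open>j\<close>.\<close>
  have flag: "P *\<^sub>v c \<in> eig_span d A"
    if "c \<in> carrier_vec d" "\<And>i. j \<le> i \<Longrightarrow> i < d \<Longrightarrow> c $ i = 0" "j \<le> d" for c j
    using that
  proof (induction j arbitrary: c)
    case 0
    then have "c = 0\<^sub>v d" by (intro eq_vecI) auto
    then have "P *\<^sub>v c = 0\<^sub>v d" using P by (intro eq_vecI) auto
    then show ?case using eig_span.zero by simp
  next
    case (Suc j)
    define \<mu> where "\<mu> = B $$ (j, j)"
    define c' where "c' = B *\<^sub>v c - \<mu> \<cdot>\<^sub>v c"
    have c': "c' \<in> carrier_vec d" using B Suc by (simp add: c'_def)
    have "c' $ i = 0" if i: "j \<le> i" "i < d" for i
    proof -
      have "(B *\<^sub>v c) $ i = (\<Sum>k<d. B $$ (i, k) * c $ k)"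
        using B i Suc by (auto simp: scalar_prod_def atLeast0LessThan intro!: sum.cong)
      \<comment> \<open>Only the term at \<open>j\<close> survives: for smaller \<open>k\<close> the
        entry of \<open>B\<close> lies below the diagonal, and for larger \<open>k\<close> the
        coordinate of \<open>c\<close> is zero.\<close>
      also have "\<dots> = (\<Sum>k<d. if k = j then B $$ (i, j) * c $ j else 0)"
      proof (rule sum.cong[OF refl])
        fix k assume k: "k \<in> {..<d}"
        consider "k < j" | "k = j" | "k \<ge> Suc j" by linarith
        then show "B $$ (i, k) * c $ k = (if k = j then B $$ (i, j) * c $ j else 0)"
        proof cases
          case 1
          then have "B $$ (i, k) = 0" using B i k by (intro upper_triangularD) auto
          then show ?thesis using 1 by simp
        qed (use Suc k in auto)
      qed
      also have "\<dots> = B $$ (i, j) * c $ j" using Suc.prems(3) by simp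
      finally have "c' $ i = B $$ (i, j) * c $ j - \<mu> * c $ i"
        using B Suc.prems i by (simp add: c'_def del: index_mult_mat_vec)
      also have "\<dots> = 0"
      proof (cases "i = j")
        case False
        then have "B $$ (i, j) = 0" using B i Suc.prems by (intro upper_triangularD) auto
        then show ?thesis using False i Suc.prems by simp
      qed (simp add: \<mu>_def)
      finally show ?thesis .
    qed
    with Suc.IH[OF c'] Suc.prems have "P *\<^sub>v c' \<in> eig_span d A" by simp
    moreover have "P *\<^sub>v c' = A *\<^sub>v (P *\<^sub>v c) - \<mu> \<cdot>\<^sub>v (P *\<^sub>v c)"
      unfolding c'_def AP'[OF Suc.prems(1)] using P B Suc.prems
      by (simp add: mult_minus_distrib_mat_vec mult_mat_vec)
    ultimately show ?case
      using hermitian_eig_span_lift[OF A, of "P *\<^sub>v c" \<mu>] P Suc.prems by simp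
  qed
  have "P *\<^sub>v (Q *\<^sub>v v) = v" using PQ P Q v by (metis assoc_mult_mat_vec one_mult_mat_vec)
  moreover have "P *\<^sub>v (Q *\<^sub>v v) \<in> eig_span d A" using Q v by (intro flag[of _ d]) auto
  ultimately show ?thesis by simp
qed

section \<open>Positive semidefinite matrices and their supports\<close>

definition psd :: "nat \<Rightarrow> complex mat \<Rightarrow> bool" where
  "psd d \<rho> \<longleftrightarrow> \<rho> \<in> carrier_mat d d \<and> adj \<rho> = \<rho> \<and>
     (\<forall>v \<in> carrier_vec d. Re (cinner v (\<rho> *\<^sub>v v)) \<ge> 0)"

lemma Supp_zero: "0\<^sub>v (dim_row \<rho>) \<in> Supp \<rho>"
  unfolding Supp_def by (rule CollectI, rule exI[of _ "[]"]) (simp add: vsum_def)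

lemma Supp_add:
  assumes s: "s \<in> Supp \<rho>" and w: "w \<in> carrier_vec (dim_row \<rho>)"
    "\<rho> *\<^sub>v w = complex_of_real r \<cdot>\<^sub>v w" "r > 0"
  shows "w + s \<in> Supp \<rho>"
proof -
  from s obtain cws where cws: "s = vsum (dim_row \<rho>) (map (\<lambda>(c,w). c \<cdot>\<^sub>v w) cws)"
    "\<forall>(c,w) \<in> set cws. w \<in> carrier_vec (dim_row \<rho>) \<and>
         (\<exists>r::real. r > 0 \<and> \<rho> *\<^sub>v w = complex_of_real r \<cdot>\<^sub>v w)"
    unfolding Supp_def by blast
  show ?thesis unfolding Supp_def
    by (rule CollectI, rule exI[of _ "(1, w) # cws"]) (use cws w in \<open>auto simp: vsum_def\<close>)
qed

text \<open>An eigenvector w with eigenvalue r > 0 is the image of w / r, and ranges are closed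
  under linear combinations.\<close>

lemma Supp_subset_range:
  assumes \<rho>: "\<rho> \<in> carrier_mat d d" and s: "s \<in> Supp \<rho>"
  shows "\<exists>v \<in> carrier_vec d. s = \<rho> *\<^sub>v v"
proof -
  have "\<exists>v \<in> carrier_vec d. vsum d (map (\<lambda>(c,w). c \<cdot>\<^sub>v w) cws) = \<rho> *\<^sub>v v"
    if "\<forall>(c,w) \<in> set cws. w \<in> carrier_vec d \<and>
         (\<exists>r::real. r > 0 \<and> \<rho> *\<^sub>v w = complex_of_real r \<cdot>\<^sub>v w)" for cws
    using that
  proof (induction cws)
    case Nil
    show ?case using \<rho> by (intro bexI[of _ "0\<^sub>v d"]) (auto simp: vsum_def mult_mat_zero_vec)
  next
    case (Cons cw cws)
    obtain c w where cw: "cw = (c, w)" by (cases cw)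
    from Cons obtain v where v: "v \<in> carrier_vec d"
      "vsum d (map (\<lambda>(c,w). c \<cdot>\<^sub>v w) cws) = \<rho> *\<^sub>v v" by auto
    from Cons.prems cw obtain r :: real where r: "r > 0" and w: "w \<in> carrier_vec d"
      and ev: "\<rho> *\<^sub>v w = complex_of_real r \<cdot>\<^sub>v w" by auto
    have "\<rho> *\<^sub>v ((c / r) \<cdot>\<^sub>v w + v) = c \<cdot>\<^sub>v w + \<rho> *\<^sub>v v"
      using \<rho> v w r by (simp add: mult_add_distrib_mat_vec mult_mat_vec ev smult_smult_assoc)
    then show ?case using v w
      by (intro bexI[of _ "(c / r) \<cdot>\<^sub>v w + v"]) (auto simp: vsum_def cw)
  qed
  then show ?thesis using s \<rho> unfolding Supp_def by auto
qed

text \<open>Write v as a sum of eigenvectors and apply \<open>\<rho>\<close>. A summand is either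
  killed or multiplied by a nonzero eigenvalue, which positivity forces to be a positive
  real.\<close>

lemma psd_range_subset_Supp:
  assumes \<rho>: "psd d \<rho>" and v: "v \<in> carrier_vec d"
  shows "\<rho> *\<^sub>v v \<in> Supp \<rho>"
proof -
  have c: "\<rho> \<in> carrier_mat d d" and h: "adj \<rho> = \<rho>"
    and pos: "\<And>v. v \<in> carrier_vec d \<Longrightarrow> Re (cinner v (\<rho> *\<^sub>v v)) \<ge> 0"
    using \<rho> by (auto simp: psd_def)
  from hermitian_eig_span[OF c h v] show ?thesis
  proof (induction rule: eig_span.induct)
    case zero
    then show ?case using Supp_zero[of \<rho>] c by (simp add: mult_mat_zero_vec)
  next
    case (add v w \<mu>)
    note vc = eig_span_carrier[OF add(1)]
    have eq: "\<rho> *\<^sub>v (v + w) = \<mu> \<cdot>\<^sub>v w + \<rho> *\<^sub>v v"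
      using c vc add by (simp add: mult_add_distrib_mat_vec)
        (intro comm_add_vec[of _ d], auto)
    show ?case
    proof (cases "\<mu> \<cdot>\<^sub>v w = 0\<^sub>v d")
      case True
      then show ?thesis using eq add c vc by simp
    next
      case False
      then have w0: "w \<noteq> 0\<^sub>v d" by auto
      have \<mu>: "\<mu> = of_real (Re \<mu>)"
        using hermitian_eigenvalue_real[OF c h add(2) w0 add(3)]
        by (simp add: complex_eq_iff)
      define s where "s = (\<Sum>i<dim_vec w. (cmod (w $ i))\<^sup>2)"
      have s: "cinner w w = of_real s" by (simp add: cinner_self s_def)
      have "s \<noteq> 0" using cinner_self_eq_0[OF add(2)] w0 s by auto
      moreover have "s \<ge> 0" unfolding s_def by (simp add: sum_nonneg)
      ultimately have "s > 0" by simp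
      have "cinner w (\<rho> *\<^sub>v w) = \<mu> * of_real s" using add by (simp add: cinner_smult_right s)
      then have "Re \<mu> * s \<ge> 0" using pos[OF add(2)] by simp
      then have "Re \<mu> \<ge> 0" using \<open>s > 0\<close> by (simp add: zero_le_mult_iff)
      moreover have "Re \<mu> \<noteq> 0" using False \<mu> add(2) by auto
      ultimately have "Re \<mu> > 0" by simp
      moreover have "\<rho> *\<^sub>v (\<mu> \<cdot>\<^sub>v w) = complex_of_real (Re \<mu>) \<cdot>\<^sub>v (\<mu> \<cdot>\<^sub>v w)"
        using c add \<mu> by (simp add: mult_mat_vec)
      ultimately show ?thesis unfolding eq using add c by (intro Supp_add) auto
    qed
  qed
qed

text \<open>Replaces the spectral definition of the support by a parametrisation through all
  vectors, which composes with further operators applied to \<open>\<rho>\<close>.\<close>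

lemma psd_Supp_eq_range:
  assumes "psd d \<rho>"
  shows "Supp \<rho> = {\<rho> *\<^sub>v v | v. v \<in> carrier_vec d}"
  using assms Supp_subset_range[of \<rho> d] psd_range_subset_Supp[of d \<rho>] by (auto simp: psd_def)

text \<open>Variational argument: with w = \<rho> v and real t, the form at v + t w equals 2 t s +
  t^2 q, where s is the squared norm of w. It can only stay nonnegative for small negative t if s =
  0.\<close>

lemma psd_kernel:
  assumes \<rho>: "psd d \<rho>" and v: "v \<in> carrier_vec d" and 0: "Re (cinner v (\<rho> *\<^sub>v v)) = 0"
  shows "\<rho> *\<^sub>v v = 0\<^sub>v d"
proof -
  have c: "\<rho> \<in> carrier_mat d d" and h: "adj \<rho> = \<rho>"
    and pos: "\<And>v. v \<in> carrier_vec d \<Longrightarrow> Re (cinner v (\<rho> *\<^sub>v v)) \<ge> 0"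
    using \<rho> by (auto simp: psd_def)
  define w where "w = \<rho> *\<^sub>v v"
  have w: "w \<in> carrier_vec d" using c v by (simp add: w_def)
  define s where "s = (\<Sum>i<dim_vec w. (cmod (w $ i))\<^sup>2)"
  have s: "cinner w w = of_real s" by (simp add: cinner_self s_def)
  have "s \<ge> 0" unfolding s_def by (simp add: sum_nonneg)
  define q where "q = Re (cinner w (\<rho> *\<^sub>v w))"
  have quad: "2 * t * s + t\<^sup>2 * q \<ge> 0" for t :: real
  proof -
    define T where "T = complex_of_real t"
    have \<rho>w: "\<rho> *\<^sub>v w \<in> carrier_vec d" using c w by simp
    have "\<rho> *\<^sub>v (v + T \<cdot>\<^sub>v w) = w + T \<cdot>\<^sub>v (\<rho> *\<^sub>v w)"
      using c v w by (simp add: mult_add_distrib_mat_vec mult_mat_vec w_def)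
    then have "cinner (v + T \<cdot>\<^sub>v w) (\<rho> *\<^sub>v (v + T \<cdot>\<^sub>v w))
        = cinner v w + T * cinner v (\<rho> *\<^sub>v w) + cnj T * (cinner w w + T * cinner w (\<rho> *\<^sub>v w))"
      using v w \<rho>w by (simp add: cinner_add_left[of _ d] cinner_add_right[of _ d]
          cinner_smult_left[of _ d] cinner_smult_right[of _ d] algebra_simps)
    moreover have "cinner v (\<rho> *\<^sub>v w) = cinner w w"
      using cinner_adj[OF c v w] h by (simp add: w_def)
    ultimately have "Re (cinner (v + T \<cdot>\<^sub>v w) (\<rho> *\<^sub>v (v + T \<cdot>\<^sub>v w))) = 2 * t * s + t\<^sup>2 * q"
      using 0[folded w_def] by (simp add: s T_def q_def power2_eq_square algebra_simps)
    then show ?thesis using pos[of "v + T \<cdot>\<^sub>v w"] v w by simp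
  qed
  have "s = 0"
  proof (rule ccontr)
    assume "s \<noteq> 0"
    then have s0: "s > 0" using \<open>s \<ge> 0\<close> by simp
    have q0: "q \<ge> 0" using pos[OF w] by (simp add: q_def)
    \<comment> \<open>The summand 1 keeps the denominator positive when \<open>q = 0\<close>; with
      this t the form equals t (s - t), which is negative.\<close>
    define t where "t = - s / (q + 1)"
    have "t * (q + 1) = - s" using q0 by (simp add: t_def)
    then have tq: "t * q = - s - t" by (simp add: algebra_simps)
    have "2 * t * s + t\<^sup>2 * q = t * (2 * s + t * q)"
      by (simp add: power2_eq_square algebra_simps)
    then have "2 * t * s + t\<^sup>2 * q = t * (s - t)" unfolding tq by simp
    moreover have "t < 0" using s0 q0 by (simp add: t_def divide_neg_pos)
    moreover have "s - t > 0" using s0 calculation(2) by simp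
    ultimately show False using quad[of t] by (simp add: zero_le_mult_iff)
  qed
  then show ?thesis using cinner_self_eq_0[OF w] s by (simp add: w_def)
qed

section \<open>When the trace of a conjugated state vanishes\<close>

lemma cinner_unit_vec:
  assumes "v \<in> carrier_vec d" "i < d"
  shows "cinner (unit_vec d i) v = v $ i"
  using assms by (simp add: cinner_def unit_vec_def if_distrib[of cnj]
      if_distrib[of "\<lambda>x. x * _"] cong: if_cong)

text \<open>Exhibits the trace as a sum of values of the quadratic form of \<open>\<rho>\<close>, so
  that nonnegativity and the case of equality can be read off termwise.\<close>

lemma tr_conj:
  assumes K: "K \<in> carrier_mat d d" and \<rho>: "\<rho> \<in> carrier_mat d d"
  shows "tr (K * \<rho> * adj K)
    = (\<Sum>i<d. cinner (adj K *\<^sub>v unit_vec d i) (\<rho> *\<^sub>v (adj K *\<^sub>v unit_vec d i)))"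
proof -
  have "(K * \<rho> * adj K) $$ (i, i)
      = cinner (adj K *\<^sub>v unit_vec d i) (\<rho> *\<^sub>v (adj K *\<^sub>v unit_vec d i))" if i: "i < d" for i
  proof -
    have "(K * \<rho> * adj K) $$ (i, i) = cinner (unit_vec d i) ((K * \<rho> * adj K) *\<^sub>v unit_vec d i)"
    proof -
      have X: "K * \<rho> * adj K \<in> carrier_mat d d"
        using K \<rho> by (intro mult_carrier_mat[of _ d d] adj_carrier)
      show ?thesis using X i
        by (subst cinner_unit_vec) (auto simp del: index_mult_mat simp: carrier_dim_vec)
    qed
    also have "\<dots> = cinner (unit_vec d i) (K *\<^sub>v (\<rho> *\<^sub>v (adj K *\<^sub>v unit_vec d i)))"
      using K \<rho> by (simp add: assoc_mult_mat_vec[of _ d d _ d])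
    finally show ?thesis using cinner_adj[OF K] K \<rho> by simp
  qed
  then show ?thesis using K unfolding tr_def by simp
qed

lemma psd_tr_conj_nonneg:
  assumes K: "K \<in> carrier_mat d d" and \<rho>: "psd d \<rho>"
  shows "Re (tr (K * \<rho> * adj K)) \<ge> 0"
proof -
  have c: "\<rho> \<in> carrier_mat d d"
    and pos: "\<And>v. v \<in> carrier_vec d \<Longrightarrow> Re (cinner v (\<rho> *\<^sub>v v)) \<ge> 0"
    using \<rho> by (auto simp: psd_def)
  show ?thesis unfolding tr_conj[OF K c] using pos K by (auto intro!: sum_nonneg)
qed

text \<open>If the sum of nonnegative terms vanishes, \<open>psd_kernel\<close> gives \<rho> K^* e_i
  = 0 for every unit vector e_i. Thus \<rho> K^* = 0, and taking adjoints yields K \<rho> =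
  0.\<close>

lemma psd_tr_conj_eq_0:
  assumes K: "K \<in> carrier_mat d d" and \<rho>: "psd d \<rho>"
  shows "Re (tr (K * \<rho> * adj K)) = 0 \<longleftrightarrow> (\<forall>v \<in> carrier_vec d. K *\<^sub>v (\<rho> *\<^sub>v v) = 0\<^sub>v d)"
proof
  have c: "\<rho> \<in> carrier_mat d d" and h: "adj \<rho> = \<rho>"
    and pos: "\<And>v. v \<in> carrier_vec d \<Longrightarrow> Re (cinner v (\<rho> *\<^sub>v v)) \<ge> 0"
    using \<rho> by (auto simp: psd_def)
  {
    assume 0: "Re (tr (K * \<rho> * adj K)) = 0"
    define u where "u i = adj K *\<^sub>v unit_vec d i" for i
    have u: "u i \<in> carrier_vec d" for i using K by (simp add: u_def)
    have "(\<Sum>i<d. Re (cinner (u i) (\<rho> *\<^sub>v u i))) = 0"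
      using 0 unfolding tr_conj[OF K c] u_def by simp
    then have "\<forall>i<d. Re (cinner (u i) (\<rho> *\<^sub>v u i)) = 0"
      using pos[OF u] by (subst (asm) sum_nonneg_eq_0_iff) auto
    then have z: "\<rho> *\<^sub>v u i = 0\<^sub>v d" if "i < d" for i using psd_kernel[OF \<rho> u] that by simp
    show "\<forall>v \<in> carrier_vec d. K *\<^sub>v (\<rho> *\<^sub>v v) = 0\<^sub>v d"
    proof (intro ballI eq_vecI)
      fix v :: "complex vec" and i assume v: "v \<in> carrier_vec d" and "i < dim_vec (0\<^sub>v d :: complex vec)"
      then have i: "i < d" by simp
      have "(K *\<^sub>v (\<rho> *\<^sub>v v)) $ i = cinner (unit_vec d i) (K *\<^sub>v (\<rho> *\<^sub>v v))"
        using K i by (subst cinner_unit_vec) (auto simp: carrier_dim_vec)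
      also have "\<dots> = cinner (\<rho> *\<^sub>v u i) v"
        using cinner_adj[OF K, of "unit_vec d i" "\<rho> *\<^sub>v v"] cinner_adj[OF c u v, of i] c v h
        by (simp add: u_def)
      finally show "(K *\<^sub>v (\<rho> *\<^sub>v v)) $ i = 0\<^sub>v d $ i" using z[OF i] v i by (simp add: cinner_zero_left)
    qed (use K in simp)
  }
  assume kill: "\<forall>v \<in> carrier_vec d. K *\<^sub>v (\<rho> *\<^sub>v v) = 0\<^sub>v d"
  have "cinner (adj K *\<^sub>v u) (\<rho> *\<^sub>v (adj K *\<^sub>v u)) = 0" if "u \<in> carrier_vec d" for u
  proof -
    have "cinner (adj K *\<^sub>v u) (\<rho> *\<^sub>v (adj K *\<^sub>v u)) = cinner u (K *\<^sub>v (\<rho> *\<^sub>v (adj K *\<^sub>v u)))"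
      using cinner_adj[OF K that, of "\<rho> *\<^sub>v (adj K *\<^sub>v u)"] K c that by simp
    then show ?thesis using kill K that by (simp add: cinner_zero_right)
  qed
  then show "Re (tr (K * \<rho> * adj K)) = 0" unfolding tr_conj[OF K c] by simp
qed

section \<open>Local operators on the joint space\<close>

lemma sum_joint: "(\<Sum>i<2 * n. f i) = (\<Sum>a<2. \<Sum>b<n. f (a * n + b))" for f :: "nat \<Rightarrow> complex"
proof -
  have "(\<Sum>i<2 * n. f i) = (\<Sum>a<2. sum f {a * n..<a * n + n})"
    by (simp only: sum.nat_group)
  also have "\<dots> = (\<Sum>a<2. \<Sum>b<n. f (a * n + b))"
  proof (rule sum.cong[OF refl])
    fix a :: nat
    show "sum f {a * n..<a * n + n} = (\<Sum>b<n. f (a * n + b))"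
      using sum.shift_bounds_nat_ivl[of f 0 "a * n" n] by (simp add: atLeast0LessThan add.commute)
  qed
  finally show ?thesis .
qed

lemma joint_index: "a < 2 \<Longrightarrow> b < n \<Longrightarrow> a * n + b < 2 * n" for a b n :: nat
  by (auto simp: less_2_cases_iff)

lemma joint_vec_eqI:
  assumes "u \<in> carrier_vec (2 * n)" "v \<in> carrier_vec (2 * n)"
    and eq: "\<And>a b. a < 2 \<Longrightarrow> b < n \<Longrightarrow> u $ (a * n + b) = v $ (a * n + b)"
  shows "u = (v :: complex vec)"
proof (rule eq_vecI)
  fix i assume "i < dim_vec v"
  then have i: "i < 2 * n" using assms by simp
  then have "i div n < 2" "i mod n < n"
    by (cases n; simp add: less_mult_imp_div_less)+
  from eq[OF this] show "u $ i = v $ i" by simp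
qed (use assms in simp)

lemma local_dim_simps [simp]: "local_dim n Alice = 2" "local_dim n Bob = n"
  by (simp_all add: local_dim_def)

lemma lift_carrier [simp, intro]:
  "M \<in> carrier_mat (local_dim n p) (local_dim n p) \<Longrightarrow> lift n p M \<in> carrier_mat (2 * n) (2 * n)"
  by (cases p) (auto simp: lift_def kron_def)

lemma dim_lift [simp]:
  assumes "M \<in> carrier_mat (local_dim n p) (local_dim n p)"
  shows "dim_row (lift n p M) = 2 * n" "dim_col (lift n p M) = 2 * n"
  using carrier_matD[OF lift_carrier[OF assms]] by auto

lemma lift_mult_vec_carrier [simp, intro]:
  "M \<in> carrier_mat (local_dim n p) (local_dim n p) \<Longrightarrow> lift n p M *\<^sub>v v \<in> carrier_vec (2 * n)"
  by (simp add: carrier_dim_vec)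

lemma index_mult_mat_vec_sum:
  assumes "A \<in> carrier_mat a b" "v \<in> carrier_vec b" "i < a"
  shows "(A *\<^sub>v v) $ i = (\<Sum>j<b. A $$ (i, j) * v $ j)"
  using assms by (auto simp: scalar_prod_def atLeast0LessThan intro!: sum.cong)

text \<open>The identity on Bob's factor leaves only the terms with the same Bob index. This formula
  and its counterpart for Bob are the base of \<open>lift_one\<close>, \<open>lift_add\<close> and
  \<open>lift_mult\<close>.\<close>

lemma lift_Alice_index:
  assumes M: "M \<in> carrier_mat 2 2" and \<psi>: "\<psi> \<in> carrier_vec (2 * n)" and ab: "a < 2" "b < n"
  shows "(lift n Alice M *\<^sub>v \<psi>) $ (a * n + b) = (\<Sum>a'<2. M $$ (a, a') * \<psi> $ (a' * n + b))"
proof -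
  have i: "a * n + b < 2 * n" using joint_index ab by blast
  have "(lift n Alice M *\<^sub>v \<psi>) $ (a * n + b)
      = (\<Sum>j<2 * n. lift n Alice M $$ (a * n + b, j) * \<psi> $ j)"
    using M \<psi> i by (intro index_mult_mat_vec_sum lift_carrier) auto
  also have "\<dots> = (\<Sum>a'<2. \<Sum>b'<n. lift n Alice M $$ (a * n + b, a' * n + b') * \<psi> $ (a' * n + b'))"
    by (rule sum_joint)
  also have "\<dots> = (\<Sum>a'<2. \<Sum>b'<n. if b' = b then M $$ (a, a') * \<psi> $ (a' * n + b') else 0)"
    using M ab i joint_index by (intro sum.cong refl) (auto simp: lift_def kron_def)
  also have "\<dots> = (\<Sum>a'<2. M $$ (a, a') * \<psi> $ (a' * n + b))" using ab by simp
  finally show ?thesis .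
qed

lemma lift_Bob_index:
  assumes M: "M \<in> carrier_mat n n" and \<psi>: "\<psi> \<in> carrier_vec (2 * n)" and ab: "a < 2" "b < n"
  shows "(lift n Bob M *\<^sub>v \<psi>) $ (a * n + b) = (\<Sum>b'<n. M $$ (b, b') * \<psi> $ (a * n + b'))"
proof -
  have i: "a * n + b < 2 * n" using joint_index ab by blast
  have "(lift n Bob M *\<^sub>v \<psi>) $ (a * n + b)
      = (\<Sum>j<2 * n. lift n Bob M $$ (a * n + b, j) * \<psi> $ j)"
    using M \<psi> i by (intro index_mult_mat_vec_sum lift_carrier) auto
  also have "\<dots> = (\<Sum>a'<2. \<Sum>b'<n. lift n Bob M $$ (a * n + b, a' * n + b') * \<psi> $ (a' * n + b'))"
    by (rule sum_joint)
  also have "\<dots> = (\<Sum>a'<2. if a' = a then \<Sum>b'<n. M $$ (b, b') * \<psi> $ (a' * n + b') else 0)"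
    using M ab i joint_index by (intro sum.cong refl) (auto simp: lift_def kron_def)
  also have "\<dots> = (\<Sum>b'<n. M $$ (b, b') * \<psi> $ (a * n + b'))" using ab by simp
  finally show ?thesis .
qed

lemma lift_one [simp]: "lift n p (1\<^sub>m (local_dim n p)) = 1\<^sub>m (2 * n)"
proof (rule eq_mat_by_mult_vec)
  fix v :: "complex vec" assume v: "v \<in> carrier_vec (2 * n)"
  have "lift n p (1\<^sub>m (local_dim n p)) *\<^sub>v v = v"
  proof (rule joint_vec_eqI)
    fix a b :: nat assume ab: "a < 2" "b < n"
    show "(lift n p (1\<^sub>m (local_dim n p)) *\<^sub>v v) $ (a * n + b) = v $ (a * n + b)"
      using v ab by (cases p) (simp_all add: lift_Alice_index lift_Bob_index
          if_distrib[of "\<lambda>x. x * _"] cong: if_cong)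
  qed (use v in auto)
  then show "lift n p (1\<^sub>m (local_dim n p)) *\<^sub>v v = 1\<^sub>m (2 * n) *\<^sub>v v" using v by simp
qed auto

lemma lift_zero:
  "lift n p (0\<^sub>m (local_dim n p) (local_dim n p)) = 0\<^sub>m (2 * n) (2 * n)"
  by (rule eq_matI; cases p)
    (auto simp: lift_def kron_def less_mult_imp_div_less)

lemma lift_add:
  assumes "A \<in> carrier_mat (local_dim n p) (local_dim n p)"
    "B \<in> carrier_mat (local_dim n p) (local_dim n p)"
  shows "lift n p (A + B) = lift n p A + lift n p B"
proof (rule eq_mat_by_mult_vec)
  fix v :: "complex vec" assume v: "v \<in> carrier_vec (2 * n)"
  show "lift n p (A + B) *\<^sub>v v = (lift n p A + lift n p B) *\<^sub>v v"
    unfolding add_mult_distrib_mat_vec[OF lift_carrier[OF assms(1)] lift_carrier[OF assms(2)] v]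
  proof (rule joint_vec_eqI)
    fix a b :: nat assume ab: "a < 2" "b < n"
    have d: "dim_vec (lift n p B *\<^sub>v v) = 2 * n" using assms by simp
    show "(lift n p (A + B) *\<^sub>v v) $ (a * n + b)
        = (lift n p A *\<^sub>v v + lift n p B *\<^sub>v v) $ (a * n + b)"
      unfolding index_add_vec(1)[OF joint_index[OF ab, folded d]]
      using v ab assms by (cases p) (simp_all add: lift_Alice_index lift_Bob_index
          sum.distrib distrib_right del: index_mult_mat_vec)
  qed (use v assms in auto)
qed (use assms in auto)

lemma lift_mult:
  assumes "A \<in> carrier_mat (local_dim n p) (local_dim n p)"
    "B \<in> carrier_mat (local_dim n p) (local_dim n p)"
  shows "lift n p (A * B) = lift n p A * lift n p B"
proof (rule eq_mat_by_mult_vec)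
  fix v :: "complex vec" assume v: "v \<in> carrier_vec (2 * n)"
  have AB: "A * B \<in> carrier_mat (local_dim n p) (local_dim n p)" using assms by auto
  show "lift n p (A * B) *\<^sub>v v = (lift n p A * lift n p B) *\<^sub>v v"
    unfolding assoc_mult_mat_vec[OF lift_carrier[OF assms(1)] lift_carrier[OF assms(2)] v]
  proof (rule joint_vec_eqI)
    fix a b :: nat assume ab: "a < 2" "b < n"
    have Bv: "lift n p B *\<^sub>v v \<in> carrier_vec (2 * n)" using assms by auto
    show "(lift n p (A * B) *\<^sub>v v) $ (a * n + b) = (lift n p A *\<^sub>v (lift n p B *\<^sub>v v)) $ (a * n + b)"
    proof (cases p)
      case Alice
      have "(\<Sum>a'<2. (A * B) $$ (a, a') * v $ (a' * n + b))
          = (\<Sum>a'<2. \<Sum>c<2. A $$ (a, c) * B $$ (c, a') * v $ (a' * n + b))"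
        using assms ab Alice by (auto simp: scalar_prod_def sum_distrib_right
            atLeast0LessThan intro!: sum.cong)
      also have "\<dots> = (\<Sum>c<2. \<Sum>a'<2. A $$ (a, c) * B $$ (c, a') * v $ (a' * n + b))"
        by (rule sum.swap)
      finally show ?thesis using assms AB Bv v ab Alice
        by (simp add: lift_Alice_index sum_distrib_left mult.assoc
            del: index_mult_mat_vec index_mult_mat)
    next
      case Bob
      have "(\<Sum>b'<n. (A * B) $$ (b, b') * v $ (a * n + b'))
          = (\<Sum>b'<n. \<Sum>c<n. A $$ (b, c) * B $$ (c, b') * v $ (a * n + b'))"
        using assms ab Bob by (auto simp: scalar_prod_def sum_distrib_right
            atLeast0LessThan intro!: sum.cong)
      also have "\<dots> = (\<Sum>c<n. \<Sum>b'<n. A $$ (b, c) * B $$ (c, b') * v $ (a * n + b'))"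
        by (rule sum.swap)
      finally show ?thesis using assms AB Bv v ab Bob
        by (simp add: lift_Bob_index sum_distrib_left mult.assoc
            del: index_mult_mat_vec index_mult_mat)
    qed
  qed (use v assms in auto)
qed (use assms in auto)

lemma lift_adj:
  assumes "A \<in> carrier_mat (local_dim n p) (local_dim n p)"
  shows "lift n p (adj A) = adj (lift n p A)"
proof (rule eq_matI)
  fix i j assume "i < dim_row (adj (lift n p A))" "j < dim_col (adj (lift n p A))"
  then have ij: "i < 2 * n" "j < 2 * n" using assms by (cases p; simp add: lift_def kron_def)+
  then have "i div n < 2" "j div n < 2" "i mod n < n" "j mod n < n"
    by (cases n; simp add: less_mult_imp_div_less)+
  then show "lift n p (adj A) $$ (i, j) = adj (lift n p A) $$ (i, j)"
    using assms ij by (cases p) (simp_all add: lift_def kron_def)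
qed (use assms in \<open>cases p; simp add: lift_def kron_def\<close>)+

lemma msum_Nil [simp]: "msum d [] = 0\<^sub>m d d"
  and msum_Cons [simp]: "msum d (M # Ms) = M + msum d Ms"
  by (simp_all add: msum_def)

lemma msum_carrier [simp, intro]: "set Ms \<subseteq> carrier_mat d d \<Longrightarrow> msum d Ms \<in> carrier_mat d d"
  by (induction Ms) auto

lemma lift_msum:
  assumes "set Ms \<subseteq> carrier_mat (local_dim n p) (local_dim n p)"
  shows "lift n p (msum (local_dim n p) Ms) = msum (2 * n) (map (lift n p) Ms)"
  using assms by (induction Ms) (simp_all add: lift_zero lift_add)

lemma cinner_msum:
  assumes "set Ms \<subseteq> carrier_mat d d" "v \<in> carrier_vec d" "w \<in> carrier_vec d"
  shows "cinner v (msum d Ms *\<^sub>v w) = (\<Sum>M\<leftarrow>Ms. cinner v (M *\<^sub>v w))"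
  using assms(1)
proof (induction Ms)
  case Nil
  have "0\<^sub>m d d *\<^sub>v w = 0\<^sub>v d" using assms by (intro eq_vecI) auto
  then show ?case using assms by (simp add: cinner_zero_right)
next
  case (Cons M Ms)
  then have "M \<in> carrier_mat d d" "msum d Ms \<in> carrier_mat d d" by auto
  then have "cinner v ((M + msum d Ms) *\<^sub>v w) = cinner v (M *\<^sub>v w) + cinner v (msum d Ms *\<^sub>v w)"
    using assms by (simp add: add_mult_distrib_mat_vec cinner_add_right[of _ d])
  then show ?case using Cons by simp
qed

section \<open>Additivity and cyclicity of the trace\<close>

lemma tr_add: "A \<in> carrier_mat d d \<Longrightarrow> B \<in> carrier_mat d d \<Longrightarrow> tr (A + B) = tr A + tr B"
  by (simp add: tr_def sum.distrib)

lemma tr_mult_commute: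
  assumes "A \<in> carrier_mat d d" "B \<in> carrier_mat d d"
  shows "tr (A * B) = tr (B * A)"
proof -
  have "tr (A * B) = (\<Sum>i<d. \<Sum>j<d. A $$ (i, j) * B $$ (j, i))"
    using assms by (simp add: tr_def scalar_prod_def atLeast0LessThan)
  also have "\<dots> = (\<Sum>j<d. \<Sum>i<d. A $$ (i, j) * B $$ (j, i))" by (rule sum.swap)
  also have "\<dots> = tr (B * A)"
    using assms by (simp add: tr_def scalar_prod_def atLeast0LessThan mult.commute)
  finally show ?thesis .
qed

lemma tr_msum:
  assumes "set Ms \<subseteq> carrier_mat d d" "X \<in> carrier_mat d d"
  shows "tr (msum d Ms * X) = (\<Sum>M\<leftarrow>Ms. tr (M * X))"
  using assms(1)
proof (induction Ms)
  case Nil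
  then show ?case using assms by (simp add: tr_def)
next
  case (Cons M Ms)
  then have "M \<in> carrier_mat d d" "msum d Ms \<in> carrier_mat d d" by auto
  then have "tr ((M + msum d Ms) * X) = tr (M * X) + tr (msum d Ms * X)"
    using assms by (simp add: add_mult_distrib_mat[of _ d d] tr_add[of _ d])
  then show ?case using Cons by simp
qed

section \<open>Protocols\<close>

text \<open>The generated induction rule reaches subprotocols through \<open>snds\<close> of the
  pairs in the list; here the hypothesis is attached to the branches themselves.\<close>

lemma protocol_induct [case_names Output Measure]:
  assumes "\<And>m. Q (Output m)"
    and "\<And>p bs. (\<And>b. b \<in> set bs \<Longrightarrow> Q (snd b)) \<Longrightarrow> Q (Measure p bs)"
  shows "Q P"
proof (induction P)
  case (Measure p bs)
  then show ?case by (intro assms(2)) (metis snds.intros)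
qed (rule assms)

lemma lifted_measurement_complete:
  assumes "wf_protocol n (Measure p bs)"
  shows "msum (2 * n) (map (\<lambda>b. adj (lift n p (fst b)) * lift n p (fst b)) bs) = 1\<^sub>m (2 * n)"
proof -
  have c: "\<And>b. b \<in> set bs \<Longrightarrow> fst b \<in> carrier_mat (local_dim n p) (local_dim n p)"
    and one: "msum (local_dim n p) (map (\<lambda>b. adj (fst b) * fst b) bs) = 1\<^sub>m (local_dim n p)"
    using assms by auto
  have "map (\<lambda>b. adj (lift n p (fst b)) * lift n p (fst b)) bs
      = map (lift n p) (map (\<lambda>b. adj (fst b) * fst b) bs)"
    using c by (auto simp: lift_mult lift_adj)
  moreover have "set (map (\<lambda>b. adj (fst b) * fst b) bs) \<subseteq> carrier_mat (local_dim n p) (local_dim n p)"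
    using c by (auto intro: mult_carrier_mat)
  ultimately show ?thesis using lift_msum one by (metis lift_one)
qed

text \<open>The completeness relation in polarised form. It lets orthogonality after all outcomes be
  summed to orthogonality before the measurement.\<close>

lemma measurement_cinner:
  assumes wf: "wf_protocol n (Measure p bs)"
    and v: "v \<in> carrier_vec (2 * n)" and w: "w \<in> carrier_vec (2 * n)"
  shows "(\<Sum>b\<leftarrow>bs. cinner (lift n p (fst b) *\<^sub>v v) (lift n p (fst b) *\<^sub>v w)) = cinner v w"
proof -
  have c: "\<And>b. b \<in> set bs \<Longrightarrow> lift n p (fst b) \<in> carrier_mat (2 * n) (2 * n)"
    using wf by auto
  have "cinner v w = cinner v (msum (2 * n)
      (map (\<lambda>b. adj (lift n p (fst b)) * lift n p (fst b)) bs) *\<^sub>v w)"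
    using lifted_measurement_complete[OF wf] w by simp
  also have "\<dots> = (\<Sum>b\<leftarrow>bs. cinner v ((adj (lift n p (fst b)) * lift n p (fst b)) *\<^sub>v w))"
    using c v w by (subst cinner_msum) (auto simp: o_def intro!: mult_carrier_mat)
  also have "map (\<lambda>b. cinner v ((adj (lift n p (fst b)) * lift n p (fst b)) *\<^sub>v w)) bs
      = map (\<lambda>b. cinner (lift n p (fst b) *\<^sub>v v) (lift n p (fst b) *\<^sub>v w)) bs"
  proof (rule map_cong[OF refl])
    fix b assume "b \<in> set bs"
    note L = c[OF this]
    show "cinner v ((adj (lift n p (fst b)) * lift n p (fst b)) *\<^sub>v w)
        = cinner (lift n p (fst b) *\<^sub>v v) (lift n p (fst b) *\<^sub>v w)"
      using cinner_adj_left[OF L v, of "lift n p (fst b) *\<^sub>v w"] L w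
        assoc_mult_mat_vec[OF adj_carrier[OF L] L w] by simp
  qed
  finally show ?thesis by simp
qed

text \<open>Conservation of total probability, from completeness and cyclicity of the trace.\<close>

lemma measurement_tr:
  assumes wf: "wf_protocol n (Measure p bs)" and X: "X \<in> carrier_mat (2 * n) (2 * n)"
  shows "(\<Sum>b\<leftarrow>bs. tr (lift n p (fst b) * X * adj (lift n p (fst b)))) = tr X"
proof -
  have c: "\<And>b. b \<in> set bs \<Longrightarrow> lift n p (fst b) \<in> carrier_mat (2 * n) (2 * n)"
    using wf by auto
  have "tr X = tr (msum (2 * n)
      (map (\<lambda>b. adj (lift n p (fst b)) * lift n p (fst b)) bs) * X)"
    using lifted_measurement_complete[OF wf] X by simp
  also have "\<dots> = (\<Sum>b\<leftarrow>bs. tr ((adj (lift n p (fst b)) * lift n p (fst b)) * X))"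
    using c X by (subst tr_msum) (auto simp: o_def intro!: mult_carrier_mat)
  also have "map (\<lambda>b. tr ((adj (lift n p (fst b)) * lift n p (fst b)) * X)) bs
      = map (\<lambda>b. tr (lift n p (fst b) * X * adj (lift n p (fst b)))) bs"
  proof (rule map_cong[OF refl])
    fix b assume "b \<in> set bs"
    note L = c[OF this]
    show "tr ((adj (lift n p (fst b)) * lift n p (fst b)) * X)
        = tr (lift n p (fst b) * X * adj (lift n p (fst b)))"
      using assoc_mult_mat[OF adj_carrier[OF L] L X]
        tr_mult_commute[OF adj_carrier[OF L] mult_carrier_mat[OF L X]] by simp
  qed
  finally show ?thesis by simp
qed

text \<open>A leaf with the wrong label must be reached with amplitude \<open>0\<close>.\<close>

fun correct_on :: "nat \<Rightarrow> protocol \<Rightarrow> complex vec \<Rightarrow> nat \<Rightarrow> bool" where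
  "correct_on n (Output m) \<psi> k \<longleftrightarrow> m = k \<or> \<psi> = 0\<^sub>v (2 * n)"
| "correct_on n (Measure p bs) \<psi> k \<longleftrightarrow>
     (\<forall>b \<in> set bs. correct_on n (snd b) (lift n p (fst b) *\<^sub>v \<psi>) k)"

text \<open>Used to conclude that a protocol attains its maximal success probability only if every
  branch attains its own.\<close>

lemma sum_list_eq_iff_pointwise:
  fixes f g :: "'a \<Rightarrow> real"
  assumes "\<And>x. x \<in> set xs \<Longrightarrow> f x \<le> g x"
  shows "(\<Sum>x\<leftarrow>xs. f x) = (\<Sum>x\<leftarrow>xs. g x) \<longleftrightarrow> (\<forall>x \<in> set xs. f x = g x)"
  using assms
proof (induction xs)
  case (Cons x xs)
  have "(\<Sum>x\<leftarrow>xs. f x) \<le> (\<Sum>x\<leftarrow>xs. g x)" using Cons.prems by (intro sum_list_mono) auto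
  moreover have "f x \<le> g x" using Cons.prems by auto
  ultimately have "f x + (\<Sum>x\<leftarrow>xs. f x) = g x + (\<Sum>x\<leftarrow>xs. g x) \<longleftrightarrow>
      f x = g x \<and> (\<Sum>x\<leftarrow>xs. f x) = (\<Sum>x\<leftarrow>xs. g x)" by linarith
  then show ?case using Cons by simp
qed simp

lemma Re_sum_list: "Re (\<Sum>x\<leftarrow>xs. f x) = (\<Sum>x\<leftarrow>xs. Re (f x))"
  by (induction xs) auto

text \<open>\<open>K\<close> is the product of the operators applied on the path so far, so that
  every node sees a conjugate of the same \<rho> and the induction only replaces \<open>K\<close> by
  \<open>L b * K\<close>. The bounds of the branches add up to the bound of the node by conservation
  of probability, so equality is a branchwise matter. At a leaf with the wrong label equality means
  trace 0, that is, K \<rho> = 0.\<close>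

lemma prob_out_conj:
  assumes \<rho>: "psd (2 * n) \<rho>" and wf: "wf_protocol n P" and K: "K \<in> carrier_mat (2 * n) (2 * n)"
  shows "prob_out n P (K * \<rho> * adj K) k \<le> Re (tr (K * \<rho> * adj K)) \<and>
    (prob_out n P (K * \<rho> * adj K) k = Re (tr (K * \<rho> * adj K)) \<longleftrightarrow>
      (\<forall>v \<in> carrier_vec (2 * n). correct_on n P (K *\<^sub>v (\<rho> *\<^sub>v v)) k))"
  using wf K
proof (induction P arbitrary: K rule: protocol_induct)
  case (Output m)
  then show ?case using psd_tr_conj_nonneg[OF Output(2) \<rho>] psd_tr_conj_eq_0[OF Output(2) \<rho>] by auto
next
  case (Measure p bs)
  note K = Measure.prems(2)
  have c: "\<rho> \<in> carrier_mat (2 * n) (2 * n)" using \<rho> by (simp add: psd_def)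
  define L where "L b = lift n p (fst b)" for b :: "complex mat \<times> protocol"
  have L: "L b \<in> carrier_mat (2 * n) (2 * n)" if "b \<in> set bs" for b
    using that Measure.prems by (auto simp: L_def)
  have X: "K * \<rho> * adj K \<in> carrier_mat (2 * n) (2 * n)"
    using K c by (intro mult_carrier_mat[of _ "2 * n" "2 * n"] adj_carrier)
  have conj: "L b * (K * \<rho> * adj K) * adj (L b) = (L b * K) * \<rho> * adj (L b * K)"
    if "b \<in> set bs" for b
    unfolding adj_mult[OF L[OF that] K] using L[OF that] K c
    by (simp add: assoc_mult_mat[of _ "2 * n" "2 * n" _ "2 * n" _ "2 * n"]
        mult_carrier_mat[of _ "2 * n" "2 * n"])
  have vec: "(L b * K) *\<^sub>v (\<rho> *\<^sub>v v) = L b *\<^sub>v (K *\<^sub>v (\<rho> *\<^sub>v v))"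
    if "b \<in> set bs" "v \<in> carrier_vec (2 * n)" for b v
    using L[OF that(1)] K c that by (intro assoc_mult_mat_vec) auto
  define f where "f b = prob_out n (snd b) (L b * (K * \<rho> * adj K) * adj (L b)) k" for b
  define g where "g b = Re (tr (L b * (K * \<rho> * adj K) * adj (L b)))" for b
  have IH: "f b \<le> g b \<and> (f b = g b \<longleftrightarrow>
      (\<forall>v \<in> carrier_vec (2 * n). correct_on n (snd b) (L b *\<^sub>v (K *\<^sub>v (\<rho> *\<^sub>v v))) k))"
    if b: "b \<in> set bs" for b
    unfolding f_def g_def conj[OF b]
    using Measure.IH[OF b, of "L b * K"] L[OF b] K Measure.prems(1) b vec[OF b]
    by (auto simp: mult_carrier_mat[of _ "2 * n" "2 * n"])
  have lhs: "prob_out n (Measure p bs) (K * \<rho> * adj K) k = (\<Sum>b\<leftarrow>bs. f b)"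
    by (simp add: f_def L_def)
  have rhs: "Re (tr (K * \<rho> * adj K)) = (\<Sum>b\<leftarrow>bs. g b)"
    using measurement_tr[OF Measure.prems(1) X] unfolding g_def L_def
    by (simp flip: Re_sum_list)
  show ?case unfolding lhs rhs
    using IH sum_list_eq_iff_pointwise[of bs f g] sum_list_mono[of bs f g]
    by (auto simp: L_def)
qed

lemma density_op_psd: "density_op d \<rho> \<Longrightarrow> psd d \<rho>"
  by (simp add: density_op_def psd_def)

text \<open>The case of \<open>prob_out_conj\<close> where \<open>K\<close> is the identity: since
  the trace is 1, success with certainty is the equality case.\<close>

lemma perfectly_discriminates_iff:
  assumes "\<forall>k \<in> {1..N}. density_op (2 * n) (\<rho> k)" and wf: "wf_protocol n P"
  shows "perfectly_discriminates n P N \<rho> \<longleftrightarrow>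
    (\<forall>k \<in> {1..N}. \<forall>\<psi> \<in> Supp (\<rho> k). correct_on n P \<psi> k)"
  unfolding perfectly_discriminates_def
proof (rule ball_cong[OF refl])
  fix k assume "k \<in> {1..N}"
  then have d: "density_op (2 * n) (\<rho> k)" using assms by blast
  then have c: "\<rho> k \<in> carrier_mat (2 * n) (2 * n)" and t: "tr (\<rho> k) = 1"
    by (auto simp: density_op_def)
  have one: "1\<^sub>m (2 * n) * \<rho> k * adj (1\<^sub>m (2 * n)) = \<rho> k" using c by simp
  have "prob_out n P (\<rho> k) k = 1 \<longleftrightarrow>
      (\<forall>v \<in> carrier_vec (2 * n). correct_on n P (1\<^sub>m (2 * n) *\<^sub>v (\<rho> k *\<^sub>v v)) k)"
    using conjunct2[OF prob_out_conj[OF density_op_psd[OF d] wf one_carrier_mat, of k]]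
    unfolding one t by simp
  also have "\<dots> \<longleftrightarrow> (\<forall>v \<in> carrier_vec (2 * n). correct_on n P (\<rho> k *\<^sub>v v) k)"
    using c by (intro ball_cong[OF refl]) (metis mult_mat_vec_carrier one_mult_mat_vec)
  also have "\<dots> \<longleftrightarrow> (\<forall>\<psi> \<in> Supp (\<rho> k). correct_on n P \<psi> k)"
    unfolding psd_Supp_eq_range[OF density_op_psd[OF d]] by blast
  finally show "prob_out n P (\<rho> k) k = 1 \<longleftrightarrow> (\<forall>\<psi> \<in> Supp (\<rho> k). correct_on n P \<psi> k)" .
qed

section \<open>Product vectors and Bob's components\<close>

definition tensor_vec :: "nat \<Rightarrow> complex vec \<Rightarrow> complex vec \<Rightarrow> complex vec" where
  "tensor_vec n e u = vec (2 * n) (\<lambda>i. e $ (i div n) * u $ (i mod n))"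

lemma tensor_vec_carrier [simp]: "tensor_vec n e u \<in> carrier_vec (2 * n)"
  by (simp add: tensor_vec_def)

lemma dim_tensor_vec [simp]: "dim_vec (tensor_vec n e u) = 2 * n"
  by (simp add: tensor_vec_def)

lemma tensor_vec_index: "a < 2 \<Longrightarrow> b < n \<Longrightarrow> tensor_vec n e u $ (a * n + b) = e $ a * u $ b"
  using joint_index[of a b n] by (simp add: tensor_vec_def)

lemma tensor_vec_smult:
  assumes "e \<in> carrier_vec 2"
  shows "tensor_vec n (c \<cdot>\<^sub>v e) u = c \<cdot>\<^sub>v tensor_vec n e u"
proof (rule eq_vecI)
  fix i assume "i < dim_vec (c \<cdot>\<^sub>v tensor_vec n e u)"
  then have "i < 2 * n" by (simp add: tensor_vec_def)
  moreover from this have "i div n < 2" by (simp add: less_mult_imp_div_less)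
  ultimately show "tensor_vec n (c \<cdot>\<^sub>v e) u $ i = (c \<cdot>\<^sub>v tensor_vec n e u) $ i"
    using assms by (simp add: tensor_vec_def)
qed (simp add: tensor_vec_def)

lemma tensor_vec_zero: "tensor_vec n e (0\<^sub>v n) = 0\<^sub>v (2 * n)"
  by (rule joint_vec_eqI[where n = n]) (auto simp: tensor_vec_index joint_index)

lemma bob_part_carrier [simp]: "bob_part n e \<psi> \<in> carrier_vec n"
  by (simp add: bob_part_def)

lemma dim_bob_part [simp]: "dim_vec (bob_part n e \<psi>) = n"
  by (simp add: bob_part_def)

lemma bob_part_index: "b < n \<Longrightarrow> bob_part n e \<psi> $ b = (\<Sum>a<2. cnj (e $ a) * \<psi> $ (a * n + b))"
  by (simp add: bob_part_def)

lemma bob_part_zero: "bob_part n e (0\<^sub>v (2 * n)) = 0\<^sub>v n"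
  by (rule eq_vecI) (auto simp: bob_part_def joint_index)

lemma bob_part_smult_left:
  "e \<in> carrier_vec 2 \<Longrightarrow> bob_part n (c \<cdot>\<^sub>v e) \<psi> = cnj c \<cdot>\<^sub>v bob_part n e \<psi>"
  by (rule eq_vecI) (auto simp: bob_part_def sum_distrib_left mult.assoc intro!: sum.cong)

text \<open>Expresses that \<open>bob_part n e\<close> is the adjoint of the embedding u \<mapsto> e
  \<otimes> u.\<close>

lemma cinner_tensor_vec:
  assumes \<psi>: "\<psi> \<in> carrier_vec (2 * n)" and u: "u \<in> carrier_vec n"
  shows "cinner \<psi> (tensor_vec n e u) = cinner (bob_part n e \<psi>) u"
proof -
  have "cinner \<psi> (tensor_vec n e u)
      = (\<Sum>a<2. \<Sum>b<n. cnj (\<psi> $ (a * n + b)) * tensor_vec n e u $ (a * n + b))"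
    using \<psi> sum_joint by (simp add: cinner_def)
  also have "\<dots> = (\<Sum>a<2. \<Sum>b<n. cnj (\<psi> $ (a * n + b)) * (e $ a * u $ b))"
    by (intro sum.cong refl) (simp add: tensor_vec_index)
  also have "\<dots> = (\<Sum>b<n. \<Sum>a<2. cnj (\<psi> $ (a * n + b)) * (e $ a * u $ b))" by (rule sum.swap)
  also have "\<dots> = cinner (bob_part n e \<psi>) u"
    unfolding cinner_def dim_bob_part
    by (rule sum.cong[OF refl]) (simp add: bob_part_index sum_distrib_left sum_distrib_right mult_ac)
  finally show ?thesis .
qed

lemma lift_Alice_tensor_vec:
  assumes M: "M \<in> carrier_mat 2 2" and e: "e \<in> carrier_vec 2"
  shows "lift n Alice M *\<^sub>v tensor_vec n e u = tensor_vec n (M *\<^sub>v e) u"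
proof (rule joint_vec_eqI)
  fix a b :: nat assume ab: "a < 2" "b < n"
  then show "(lift n Alice M *\<^sub>v tensor_vec n e u) $ (a * n + b)
      = tensor_vec n (M *\<^sub>v e) u $ (a * n + b)"
    using M e by (simp add: lift_Alice_index tensor_vec_index index_mult_mat_vec_sum
        sum_distrib_right mult.assoc del: index_mult_mat_vec)
qed (use M in auto)

lemma lift_Bob_tensor_vec:
  assumes M: "M \<in> carrier_mat n n" and u: "u \<in> carrier_vec n"
  shows "lift n Bob M *\<^sub>v tensor_vec n e u = tensor_vec n e (M *\<^sub>v u)"
proof (rule joint_vec_eqI)
  fix a b :: nat assume ab: "a < 2" "b < n"
  then show "(lift n Bob M *\<^sub>v tensor_vec n e u) $ (a * n + b)
      = tensor_vec n e (M *\<^sub>v u) $ (a * n + b)"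
    using M u by (simp add: lift_Bob_index tensor_vec_index index_mult_mat_vec_sum
        sum_distrib_left mult.left_commute del: index_mult_mat_vec)
qed (use M in auto)

text \<open>An operator of Alice can be moved onto the bra: <e| M is the bra of M^* e. This is how a
  measurement of hers turns into a change of basis.\<close>

lemma bob_part_lift_Alice:
  assumes M: "M \<in> carrier_mat 2 2" and e: "e \<in> carrier_vec 2" and \<psi>: "\<psi> \<in> carrier_vec (2 * n)"
  shows "bob_part n e (lift n Alice M *\<^sub>v \<psi>) = bob_part n (adj M *\<^sub>v e) \<psi>"
proof (rule eq_vecI)
  fix b assume "b < dim_vec (bob_part n (adj M *\<^sub>v e) \<psi>)"
  then have b: "b < n" by (simp add: bob_part_def)
  have adjM: "(adj M *\<^sub>v e) $ a = (\<Sum>a'<2. cnj (M $$ (a', a)) * e $ a')" if "a < 2" for a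
    using M e that by (subst index_mult_mat_vec_sum[of _ 2 2]) (auto intro!: sum.cong)
  have "bob_part n e (lift n Alice M *\<^sub>v \<psi>) $ b
      = (\<Sum>a<2. \<Sum>a'<2. cnj (e $ a) * (M $$ (a, a') * \<psi> $ (a' * n + b)))"
    using M \<psi> b by (simp add: bob_part_index lift_Alice_index sum_distrib_left
        del: index_mult_mat_vec)
  also have "\<dots> = (\<Sum>a'<2. \<Sum>a<2. cnj (e $ a) * (M $$ (a, a') * \<psi> $ (a' * n + b)))"
    by (rule sum.swap)
  also have "\<dots> = bob_part n (adj M *\<^sub>v e) \<psi> $ b"
    using b by (simp add: bob_part_index adjM sum_distrib_left sum_distrib_right mult_ac
        del: index_mult_mat_vec)
  finally show "bob_part n e (lift n Alice M *\<^sub>v \<psi>) $ b = bob_part n (adj M *\<^sub>v e) \<psi> $ b" .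
qed (simp add: bob_part_def)

lemma bob_part_lift_Bob:
  assumes M: "M \<in> carrier_mat n n" and \<psi>: "\<psi> \<in> carrier_vec (2 * n)"
  shows "bob_part n e (lift n Bob M *\<^sub>v \<psi>) = M *\<^sub>v bob_part n e \<psi>"
proof (rule eq_vecI)
  fix b assume "b < dim_vec (M *\<^sub>v bob_part n e \<psi>)"
  then have b: "b < n" using M by simp
  have "bob_part n e (lift n Bob M *\<^sub>v \<psi>) $ b
      = (\<Sum>a<2. \<Sum>b'<n. cnj (e $ a) * (M $$ (b, b') * \<psi> $ (a * n + b')))"
    using M \<psi> b by (simp add: bob_part_index lift_Bob_index sum_distrib_left
        del: index_mult_mat_vec)
  also have "\<dots> = (\<Sum>b'<n. \<Sum>a<2. cnj (e $ a) * (M $$ (b, b') * \<psi> $ (a * n + b')))"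
    by (rule sum.swap)
  also have "\<dots> = (M *\<^sub>v bob_part n e \<psi>) $ b"
    using b M by (simp add: bob_part_index index_mult_mat_vec_sum[OF M bob_part_carrier]
        sum_distrib_left mult_ac del: index_mult_mat_vec)
  finally show "bob_part n e (lift n Bob M *\<^sub>v \<psi>) $ b = (M *\<^sub>v bob_part n e \<psi>) $ b" .
qed (use M in \<open>simp add: bob_part_def\<close>)

section \<open>Orthonormal bases of the qubit\<close>

definition onb :: "complex vec \<Rightarrow> complex vec \<Rightarrow> bool" where
  "onb e0 e1 \<longleftrightarrow> e0 \<in> carrier_vec 2 \<and> e1 \<in> carrier_vec 2 \<and>
     cinner e0 e0 = 1 \<and> cinner e1 e1 = 1 \<and> cinner e0 e1 = 0"

text \<open>The matrix U with columns \<open>e0\<close> and \<open>e1\<close> satisfies U^* U = 1 by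
  orthonormality. As U is square, also U U^* = 1, and its entries give the claim.\<close>

lemma onb_completeness:
  assumes "onb e0 e1" "a < 2" "a' < 2"
  shows "e0 $ a * cnj (e0 $ a') + e1 $ a * cnj (e1 $ a') = (if a = a' then 1 else 0)"
proof -
  have e: "e0 \<in> carrier_vec 2" "e1 \<in> carrier_vec 2"
    "cinner e0 e0 = 1" "cinner e1 e1 = 1" "cinner e0 e1 = 0"
    using assms by (auto simp: onb_def)
  have "cinner e1 e0 = 0" using cinner_commute[OF e(2,1)] e by simp
  define U where "U = mat 2 2 (\<lambda>(a, i). if i = 0 then e0 $ a else e1 $ a)"
  have U: "U \<in> carrier_mat 2 2" by (simp add: U_def)
  have "adj U * U = 1\<^sub>m 2"
  proof (rule eq_matI)
    fix i j assume "i < dim_row (1\<^sub>m 2 :: complex mat)" "j < dim_col (1\<^sub>m 2 :: complex mat)"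
    then have ij: "i < 2" "j < 2" by auto
    have "(adj U * U) $$ (i, j) = cinner (if i = 0 then e0 else e1) (if j = 0 then e0 else e1)"
      using ij e(1,2) by (auto simp: U_def scalar_prod_def cinner_def atLeast0LessThan intro!: sum.cong)
    then show "(adj U * U) $$ (i, j) = 1\<^sub>m 2 $$ (i, j)"
      using ij e \<open>cinner e1 e0 = 0\<close> by (auto simp: less_2_cases_iff)
  qed (auto simp: U_def)
  then have "U * adj U = 1\<^sub>m 2" using mat_mult_left_right_inverse[OF adj_carrier[OF U] U] by simp
  then have "(U * adj U) $$ (a, a') = (if a = a' then 1 else 0)" using assms by simp
  moreover have "(U * adj U) $$ (a, a') = e0 $ a * cnj (e0 $ a') + e1 $ a * cnj (e1 $ a')"
    using assms by (simp add: U_def scalar_prod_def numeral_2_eq_2)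
  ultimately show ?thesis by simp
qed

lemma onb_expansion:
  assumes onb: "onb e0 e1" and \<phi>: "\<phi> \<in> carrier_vec (2 * n)"
  shows "\<phi> = tensor_vec n e0 (bob_part n e0 \<phi>) + tensor_vec n e1 (bob_part n e1 \<phi>)"
proof (rule joint_vec_eqI)
  fix a b :: nat assume ab: "a < 2" "b < n"
  have "\<phi> $ (a * n + b) = (\<Sum>a'<2. (if a = a' then 1 else 0) * \<phi> $ (a' * n + b))"
    using ab by (simp add: if_distrib[of "\<lambda>x. x * _"] cong: if_cong)
  also have "\<dots> = (\<Sum>a'<2. (e0 $ a * cnj (e0 $ a') + e1 $ a * cnj (e1 $ a')) * \<phi> $ (a' * n + b))"
    by (intro sum.cong refl arg_cong2[where f = "(*)"])
      (use onb_completeness[OF onb ab(1)] in simp)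
  also have "\<dots> = e0 $ a * bob_part n e0 \<phi> $ b + e1 $ a * bob_part n e1 \<phi> $ b"
    using ab by (simp add: bob_part_index sum_distrib_left sum.distrib distrib_right mult.assoc)
  also have "\<dots> = (tensor_vec n e0 (bob_part n e0 \<phi>) + tensor_vec n e1 (bob_part n e1 \<phi>)) $ (a * n + b)"
    using ab joint_index[OF ab] by (subst index_add_vec) (simp_all add: tensor_vec_index)
  finally show "\<phi> $ (a * n + b)
      = (tensor_vec n e0 (bob_part n e0 \<phi>) + tensor_vec n e1 (bob_part n e1 \<phi>)) $ (a * n + b)" .
qed (use \<phi> in auto)

lemma scalar_mat_mult_vec:
  fixes x :: "complex vec"
  assumes "x \<in> carrier_vec d"
  shows "(c \<cdot>\<^sub>m 1\<^sub>m d) *\<^sub>v x = c \<cdot>\<^sub>v x"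
  using assms
  by (intro eq_vecI) (auto simp: index_mult_mat_vec_sum[of _ d d] if_distrib[of "\<lambda>x. x * _"]
      if_distrib[of "\<lambda>x. _ * x"] simp del: index_mult_mat_vec cong: if_cong)

text \<open>If all eigenvectors shared one eigenvalue \<mu>, then H would act as \<mu> on their
  sums, hence on every vector.\<close>

lemma hermitian_two_eigenvalues:
  assumes H: "H \<in> carrier_mat d d" "adj H = H" and ns: "\<nexists>c. H = c \<cdot>\<^sub>m 1\<^sub>m d"
  shows "\<exists>v w \<mu> \<nu>. v \<in> carrier_vec d \<and> w \<in> carrier_vec d \<and> v \<noteq> 0\<^sub>v d \<and> w \<noteq> 0\<^sub>v d \<and>
    H *\<^sub>v v = \<mu> \<cdot>\<^sub>v v \<and> H *\<^sub>v w = \<nu> \<cdot>\<^sub>v w \<and> \<mu> \<noteq> \<nu>"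
proof (rule ccontr)
  assume no: "\<not> ?thesis"
  \<comment> \<open>When there is no nonzero eigenvector at all, the condition is vacuous and any
    \<mu> serves.\<close>
  have "\<exists>\<mu>. \<forall>w \<nu>. w \<in> carrier_vec d \<longrightarrow> w \<noteq> 0\<^sub>v d \<longrightarrow> H *\<^sub>v w = \<nu> \<cdot>\<^sub>v w \<longrightarrow> \<nu> = \<mu>"
  proof (cases "\<exists>v \<mu>. v \<in> carrier_vec d \<and> v \<noteq> 0\<^sub>v d \<and> H *\<^sub>v v = \<mu> \<cdot>\<^sub>v v")
    case True
    then obtain v \<mu> where "v \<in> carrier_vec d" "v \<noteq> 0\<^sub>v d" "H *\<^sub>v v = \<mu> \<cdot>\<^sub>v v" by blast
    then show ?thesis using no by (intro exI[of _ \<mu>]) blast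
  qed blast
  then obtain \<mu> where \<mu>: "\<And>w \<nu>. w \<in> carrier_vec d \<Longrightarrow> w \<noteq> 0\<^sub>v d \<Longrightarrow> H *\<^sub>v w = \<nu> \<cdot>\<^sub>v w \<Longrightarrow> \<nu> = \<mu>"
    by blast
  have "H *\<^sub>v x = \<mu> \<cdot>\<^sub>v x" if "x \<in> carrier_vec d" for x
    using hermitian_eig_span[OF H that]
  proof (induction rule: eig_span.induct)
    case zero
    show ?case using H by (auto simp: mult_mat_zero_vec)
  next
    case (add v w \<nu>)
    have "H *\<^sub>v w = \<mu> \<cdot>\<^sub>v w"
    proof (cases "w = 0\<^sub>v d")
      case True
      then show ?thesis using H by (auto simp: mult_mat_zero_vec)
    qed (use \<mu>[OF add(2) _ add(3)] add(3) in simp)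
    then show ?case using add H eig_span_carrier[OF add(1)]
      by (simp add: mult_add_distrib_mat_vec smult_add_distrib_vec)
  qed
  then have "H = \<mu> \<cdot>\<^sub>m 1\<^sub>m d"
    using H by (intro eq_mat_by_mult_vec[of _ d d]) (auto simp: scalar_mat_mult_vec)
  then show False using ns by blast
qed

lemma normalise_orthogonal:
  assumes "v \<in> carrier_vec 2" "w \<in> carrier_vec 2" "v \<noteq> 0\<^sub>v 2" "w \<noteq> 0\<^sub>v 2" "cinner v w = 0"
  shows "\<exists>c d. onb (c \<cdot>\<^sub>v v) (d \<cdot>\<^sub>v w)"
proof -
  obtain c where c: "cinner (c \<cdot>\<^sub>v v) (c \<cdot>\<^sub>v v) = 1"
    using exists_normalised_multiple[OF assms(1,3)] by blast
  obtain d where d: "cinner (d \<cdot>\<^sub>v w) (d \<cdot>\<^sub>v w) = 1"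
    using exists_normalised_multiple[OF assms(2,4)] by blast
  have "cinner (c \<cdot>\<^sub>v v) (d \<cdot>\<^sub>v w) = 0"
    using assms by (simp add: cinner_smult_left[of _ 2] cinner_smult_right[of _ 2])
  then have "onb (c \<cdot>\<^sub>v v) (d \<cdot>\<^sub>v w)" using assms c d by (simp add: onb_def)
  then show ?thesis by blast
qed

section \<open>Necessity\<close>

text \<open>A leaf carries one label, which cannot equal both k and l, so one of the two vectors has
  become zero there. \<open>measurement_cinner\<close> carries the orthogonality up the
  tree.\<close>

lemma correct_on_orthogonal:
  assumes "wf_protocol n P" "\<psi> \<in> carrier_vec (2 * n)" "\<phi> \<in> carrier_vec (2 * n)"
    and "correct_on n P \<psi> k" "correct_on n P \<phi> l" and kl: "k \<noteq> l"
  shows "cinner \<psi> \<phi> = 0"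
  using assms(1-5)
proof (induction P arbitrary: \<psi> \<phi> rule: protocol_induct)
  case (Output m)
  then show ?case using kl by (auto simp: cinner_zero_left cinner_zero_right)
next
  case (Measure p bs)
  have "cinner (lift n p (fst b) *\<^sub>v \<psi>) (lift n p (fst b) *\<^sub>v \<phi>) = 0" if "b \<in> set bs" for b
    using that Measure.prems by (intro Measure.IH[OF that]) auto
  then have "(\<Sum>b\<leftarrow>bs. cinner (lift n p (fst b) *\<^sub>v \<psi>) (lift n p (fst b) *\<^sub>v \<phi>)) = 0"
    by (simp cong: map_cong)
  then show ?case using measurement_cinner[OF Measure.prems(1-3)] by simp
qed

text \<open>Stated for an arbitrary family indexed by all naturals, so that it applies to images
  under measurement operators. Indices without a state receive the empty set.\<close>

definition separates :: "nat \<Rightarrow> complex vec \<Rightarrow> (nat \<Rightarrow> complex vec set) \<Rightarrow> bool" where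
  "separates n e S \<longleftrightarrow> (\<forall>k l. k \<noteq> l \<longrightarrow> (\<forall>\<psi> \<in> S k. \<forall>\<phi> \<in> S l.
     cinner (bob_part n e \<psi>) (bob_part n e \<phi>) = 0))"

lemma separates_smult:
  assumes "e \<in> carrier_vec 2" "separates n e S"
  shows "separates n (c \<cdot>\<^sub>v e) S"
  using assms by (auto simp: separates_def bob_part_smult_left cinner_smult_left[of _ n]
      cinner_smult_right[of _ n])

text \<open>In the eigenbasis of \<open>M\<^sup>\<dagger>M\<close>, the two orthogonality relations before and after the
  outcome \<open>M\<close> form a linear system with determinant \<open>\<nu> - \<mu> \<noteq> 0\<close> for the two inner products
  of the Bob parts.\<close>

lemma nontrivial_outcome_separates:
  assumes M: "M \<in> carrier_mat 2 2" "\<not> trivial_op M"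
    and S: "\<And>k. S k \<subseteq> carrier_vec (2 * n)"
    and before: "\<And>k l \<psi> \<phi>. k \<noteq> l \<Longrightarrow> \<psi> \<in> S k \<Longrightarrow> \<phi> \<in> S l \<Longrightarrow> cinner \<psi> \<phi> = 0"
    and after: "\<And>k l \<psi> \<phi>. k \<noteq> l \<Longrightarrow> \<psi> \<in> S k \<Longrightarrow> \<phi> \<in> S l \<Longrightarrow>
      cinner (lift n Alice M *\<^sub>v \<psi>) (lift n Alice M *\<^sub>v \<phi>) = 0"
  shows "\<exists>e0 e1. onb e0 e1 \<and> separates n e0 S \<and> separates n e1 S"
proof -
  define H where "H = adj M * M"
  have H: "H \<in> carrier_mat 2 2" "adj H = H"
    using M(1) by (auto simp: H_def adj_mult[OF adj_carrier[OF M(1)] M(1)])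
  have "\<nexists>c. H = c \<cdot>\<^sub>m 1\<^sub>m 2" using M by (auto simp: trivial_op_def H_def)
  from hermitian_two_eigenvalues[OF H this] obtain v w \<mu> \<nu>
    where v: "v \<in> carrier_vec 2" "v \<noteq> 0\<^sub>v 2" "H *\<^sub>v v = \<mu> \<cdot>\<^sub>v v"
      and w: "w \<in> carrier_vec 2" "w \<noteq> 0\<^sub>v 2" "H *\<^sub>v w = \<nu> \<cdot>\<^sub>v w" and ne: "\<mu> \<noteq> \<nu>" by blast
  from normalise_orthogonal[OF v(1) w(1) v(2) w(2)
      hermitian_eigenvectors_orthogonal[OF H v(1) w(1) v(3) w(3) ne]]
  obtain c d where onb: "onb (c \<cdot>\<^sub>v v) (d \<cdot>\<^sub>v w)" by blast
  define e0 e1 where "e0 = c \<cdot>\<^sub>v v" and "e1 = d \<cdot>\<^sub>v w"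
  have e: "e0 \<in> carrier_vec 2" "e1 \<in> carrier_vec 2" "onb e0 e1"
    using v w onb by (auto simp: e0_def e1_def)
  have ev: "H *\<^sub>v e0 = \<mu> \<cdot>\<^sub>v e0" "H *\<^sub>v e1 = \<nu> \<cdot>\<^sub>v e1"
    using H v w by (auto simp: e0_def e1_def mult_mat_vec smult_smult_assoc mult.commute)
  have zero: "cinner (bob_part n e0 \<psi>) (bob_part n e0 \<phi>) = 0 \<and>
      cinner (bob_part n e1 \<psi>) (bob_part n e1 \<phi>) = 0"
    if kl: "k \<noteq> l" and \<psi>S: "\<psi> \<in> S k" and \<phi>S: "\<phi> \<in> S l" for k l \<psi> \<phi>
  proof -
    have \<psi>: "\<psi> \<in> carrier_vec (2 * n)" and \<phi>: "\<phi> \<in> carrier_vec (2 * n)" using S that by blast+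
    define t0 t1 where "t0 = tensor_vec n e0 (bob_part n e0 \<phi>)"
      and "t1 = tensor_vec n e1 (bob_part n e1 \<phi>)"
    define x0 x1 where "x0 = cinner (bob_part n e0 \<psi>) (bob_part n e0 \<phi>)"
      and "x1 = cinner (bob_part n e1 \<psi>) (bob_part n e1 \<phi>)"
    have t: "t0 \<in> carrier_vec (2 * n)" "t1 \<in> carrier_vec (2 * n)" by (auto simp: t0_def t1_def)
    have \<phi>t: "\<phi> = t0 + t1" unfolding t0_def t1_def by (rule onb_expansion[OF e(3) \<phi>])
    have x: "cinner \<psi> t0 = x0" "cinner \<psi> t1 = x1"
      using \<psi> by (auto simp: t0_def t1_def x0_def x1_def cinner_tensor_vec)
    have "x0 + x1 = cinner \<psi> \<phi>" using \<psi> t x by (simp add: \<phi>t cinner_add_right)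
    then have 1: "x0 + x1 = 0" using before that by simp
    have L: "lift n Alice M \<in> carrier_mat (2 * n) (2 * n)"
      and LH: "lift n Alice H \<in> carrier_mat (2 * n) (2 * n)" using M H by auto
    have "lift n Alice H = adj (lift n Alice M) * lift n Alice M"
      using M by (simp add: H_def lift_mult lift_adj)
    then have "cinner \<psi> (lift n Alice H *\<^sub>v \<phi>)
        = cinner (lift n Alice M *\<^sub>v \<psi>) (lift n Alice M *\<^sub>v \<phi>)"
      using assoc_mult_mat_vec[OF adj_carrier[OF L] L \<phi>]
        cinner_adj_left[OF L \<psi>, of "lift n Alice M *\<^sub>v \<phi>"] M by simp
    \<comment> \<open>\<open>H\<close> acts on Alice's factor alone, so the product vectors
      \<open>t0\<close> and \<open>t1\<close> inherit the eigenvalues of \<open>e0\<close> and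
      \<open>e1\<close>.\<close>
    moreover have "lift n Alice H *\<^sub>v t0 = \<mu> \<cdot>\<^sub>v t0" "lift n Alice H *\<^sub>v t1 = \<nu> \<cdot>\<^sub>v t1"
      using H e by (simp_all add: t0_def t1_def lift_Alice_tensor_vec ev tensor_vec_smult)
    then have "lift n Alice H *\<^sub>v \<phi> = \<mu> \<cdot>\<^sub>v t0 + \<nu> \<cdot>\<^sub>v t1"
      using mult_add_distrib_mat_vec[OF LH t] by (simp only: \<phi>t)
    ultimately have 2: "\<mu> * x0 + \<nu> * x1 = 0"
      using after[OF that] \<psi> t x
      by (simp add: cinner_add_right[of _ "2 * n"] cinner_smult_right[of _ "2 * n"])
    have "x1 = - x0" using 1 by (simp add: add_eq_0_iff)
    with 2 have "(\<mu> - \<nu>) * x0 = 0" by (simp add: algebra_simps)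
    then have "x0 = 0" using ne by simp
    with 1 show ?thesis by (simp add: x0_def x1_def)
  qed
  then show ?thesis using e(3) unfolding separates_def by blast
qed

text \<open>By \<open>bob_part_lift_Alice\<close>, components along e after M are components along
  M^* e before it. As M is a nonzero multiple of a unitary, M^* preserves orthogonality and kills no
  basis vector, so the normalised images of \<open>e0\<close> and \<open>e1\<close> form the
  required basis.\<close>

lemma trivial_outcome_pull_back_Alice:
  assumes M: "M \<in> carrier_mat 2 2" and c: "adj M * M = c \<cdot>\<^sub>m 1\<^sub>m 2" "c \<noteq> 0"
    and S: "\<And>k. S k \<subseteq> carrier_vec (2 * n)"
    and onb: "onb e0 e1" and sep: "separates n e0 (\<lambda>k. (*\<^sub>v) (lift n Alice M) ` S k)"
      "separates n e1 (\<lambda>k. (*\<^sub>v) (lift n Alice M) ` S k)"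
  shows "\<exists>e0 e1. onb e0 e1 \<and> separates n e0 S \<and> separates n e1 S"
proof -
  have e: "e0 \<in> carrier_vec 2" "e1 \<in> carrier_vec 2"
    "cinner e0 e0 = 1" "cinner e1 e1 = 1" "cinner e0 e1 = 0"
    using onb by (auto simp: onb_def)
  \<comment> \<open>The hypothesis gives a left inverse of the square matrix \<open>M\<close>. It is
    also a right inverse, which yields M M^* = c, the relation needed for inner products of M^* u
    and M^* v.\<close>
  have "(inverse c \<cdot>\<^sub>m adj M) * M = 1\<^sub>m 2"
  proof -
    have "(inverse c \<cdot>\<^sub>m adj M) * M = inverse c \<cdot>\<^sub>m (adj M * M)"
      by (rule mult_smult_assoc_mat[OF adj_carrier[OF M] M])
    also have "\<dots> = 1\<^sub>m 2" unfolding c using c(2) by (intro eq_matI) auto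
    finally show ?thesis .
  qed
  then have inv: "M * (inverse c \<cdot>\<^sub>m adj M) = 1\<^sub>m 2"
    using M by (intro mat_mult_left_right_inverse[of "inverse c \<cdot>\<^sub>m adj M" 2 M]) auto
  have MM: "M * adj M = c \<cdot>\<^sub>m 1\<^sub>m 2"
  proof -
    have "c \<cdot>\<^sub>m (M * (inverse c \<cdot>\<^sub>m adj M)) = M * adj M"
      unfolding mult_smult_distrib[OF M adj_carrier[OF M]] using M c(2) by (intro eq_matI) auto
    then show ?thesis unfolding inv by simp
  qed
  have inner: "cinner (adj M *\<^sub>v u) (adj M *\<^sub>v v) = c * cinner u v"
    if "u \<in> carrier_vec 2" "v \<in> carrier_vec 2" for u v
  proof -
    have "cinner (adj M *\<^sub>v u) (adj M *\<^sub>v v) = cinner u ((M * adj M) *\<^sub>v v)"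
      using cinner_adj[OF M that(1) adj_mult_vec_carrier[OF M]]
        assoc_mult_mat_vec[OF M adj_carrier[OF M] that(2)] by simp
    then show ?thesis using that by (simp add: MM scalar_mat_mult_vec cinner_smult_right)
  qed
  have f: "adj M *\<^sub>v e0 \<in> carrier_vec 2" "adj M *\<^sub>v e1 \<in> carrier_vec 2" using M by auto
  have "adj M *\<^sub>v e0 \<noteq> 0\<^sub>v 2" "adj M *\<^sub>v e1 \<noteq> 0\<^sub>v 2"
    using inner[OF e(1,1)] inner[OF e(2,2)] e c(2) f by (auto simp flip: cinner_self_eq_0)
  moreover have "cinner (adj M *\<^sub>v e0) (adj M *\<^sub>v e1) = 0" using inner[OF e(1,2)] e by simp
  ultimately obtain a b where ab: "onb (a \<cdot>\<^sub>v (adj M *\<^sub>v e0)) (b \<cdot>\<^sub>v (adj M *\<^sub>v e1))"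
    using normalise_orthogonal[OF f] by blast
  have pull: "separates n (adj M *\<^sub>v x) S"
    if "x \<in> carrier_vec 2" "separates n x (\<lambda>k. (*\<^sub>v) (lift n Alice M) ` S k)" for x
    unfolding separates_def
  proof (intro allI impI ballI)
    fix k l \<psi> \<phi> assume *: "k \<noteq> l" "\<psi> \<in> S k" "\<phi> \<in> S l"
    then have "\<psi> \<in> carrier_vec (2 * n)" "\<phi> \<in> carrier_vec (2 * n)" using S by blast+
    then show "cinner (bob_part n (adj M *\<^sub>v x) \<psi>) (bob_part n (adj M *\<^sub>v x) \<phi>) = 0"
      using that * M unfolding separates_def by (auto simp flip: bob_part_lift_Alice)
  qed
  show ?thesis
    using ab separates_smult[OF f(1) pull[OF e(1) sep(1)]] separates_smult[OF f(2) pull[OF e(2) sep(2)]]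
    by blast
qed

text \<open>Bob's operator commutes with taking components along \<open>e\<close> and multiplies
  their inner products by \<open>c\<close>, so Alice's basis stays the same.\<close>

lemma trivial_outcome_pull_back_Bob:
  assumes M: "M \<in> carrier_mat n n" and c: "adj M * M = c \<cdot>\<^sub>m 1\<^sub>m n" "c \<noteq> 0"
    and S: "\<And>k. S k \<subseteq> carrier_vec (2 * n)"
    and sep: "separates n e (\<lambda>k. (*\<^sub>v) (lift n Bob M) ` S k)"
  shows "separates n e S"
  unfolding separates_def
proof (intro allI impI ballI)
  fix k l \<psi> \<phi> assume *: "k \<noteq> l" "\<psi> \<in> S k" "\<phi> \<in> S l"
  then have \<psi>: "\<psi> \<in> carrier_vec (2 * n)" and \<phi>: "\<phi> \<in> carrier_vec (2 * n)" using S by blast+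
  let ?u = "bob_part n e \<psi>" and ?v = "bob_part n e \<phi>"
  have "cinner (M *\<^sub>v ?u) (M *\<^sub>v ?v) = 0"
    using sep * M \<psi> \<phi> unfolding separates_def by (auto simp flip: bob_part_lift_Bob)
  moreover have "cinner (M *\<^sub>v ?u) (M *\<^sub>v ?v) = cinner ?u ((adj M * M) *\<^sub>v ?v)"
    using cinner_adj_left[OF M bob_part_carrier, of "M *\<^sub>v ?v"] M
      assoc_mult_mat_vec[OF adj_carrier[OF M] M bob_part_carrier] by simp
  ultimately show "cinner ?u ?v = 0"
    using c(2) by (simp add: c(1) scalar_mat_mult_vec cinner_smult_right[of _ n])
qed

text \<open>If all constants were zero, the operators would sum to 0 instead of the identity. The
  bound on \<open>n\<close> ensures that Bob's identity matrix has an entry to compare.\<close>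

lemma trivial_measurement_has_nonzero_outcome:
  assumes wf: "wf_protocol n (Measure p bs)" and n: "n \<ge> 1"
    and triv: "\<And>b. b \<in> set bs \<Longrightarrow> trivial_op (fst b)"
  shows "\<exists>b \<in> set bs. \<exists>c. c \<noteq> 0 \<and> adj (fst b) * fst b = c \<cdot>\<^sub>m 1\<^sub>m (local_dim n p)"
proof (rule ccontr)
  assume no: "\<not> ?thesis"
  define d where "d = local_dim n p"
  have d: "d > 0" using n by (cases p) (auto simp: d_def)
  have c: "\<And>b. b \<in> set bs \<Longrightarrow> fst b \<in> carrier_mat d d"
    and one: "msum d (map (\<lambda>b. adj (fst b) * fst b) bs) = 1\<^sub>m d"
    using wf by (auto simp: d_def)
  have "adj (fst b) * fst b = 0\<^sub>m d d" if b: "b \<in> set bs" for b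
  proof -
    obtain a where a: "adj (fst b) * fst b = a \<cdot>\<^sub>m 1\<^sub>m d"
      using triv[OF b] c[OF b] by (auto simp: trivial_op_def)
    then have "a = 0" using no b by (auto simp: d_def)
    then show ?thesis unfolding a by (intro eq_matI) auto
  qed
  then have "map (\<lambda>b. adj (fst b) * fst b) bs = map (\<lambda>b. 0\<^sub>m d d) bs" by simp
  moreover have "msum d (map (\<lambda>b. 0\<^sub>m d d) bs) = 0\<^sub>m d d" by (induction bs) auto
  ultimately have "1\<^sub>m d = (0\<^sub>m d d :: complex mat)" using one by metis
  then have "1\<^sub>m d $$ (0, 0) = (0\<^sub>m d d :: complex mat) $$ (0, 0)" by simp
  then show False using d by simp
qed

text \<open>The induction follows a single path and stops at the first measurement with a
  non-trivial operator. Below that point the protocol contributes only the orthogonality of the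
  post-measurement vectors.\<close>

lemma alice_first_separates:
  assumes n: "n \<ge> 1" and "wf_protocol n P" "alice_first P"
    and "\<And>k. S k \<subseteq> carrier_vec (2 * n)" and "\<And>k \<psi>. \<psi> \<in> S k \<Longrightarrow> correct_on n P \<psi> k"
  shows "\<exists>e0 e1. onb e0 e1 \<and> separates n e0 S \<and> separates n e1 S"
  using assms(2-)
proof (induction P arbitrary: S rule: protocol_induct)
  case (Output m)
  \<comment> \<open>Of two different indices at least one disagrees with the leaf, so its vectors
    are zero; the standard basis is then an arbitrary choice.\<close>
  have "separates n e S" for e
    unfolding separates_def
  proof (intro allI impI ballI)
    fix k l \<psi> \<phi> assume "k \<noteq> l" "\<psi> \<in> S k" "\<phi> \<in> S l"
    then have "\<psi> = 0\<^sub>v (2 * n) \<or> \<phi> = 0\<^sub>v (2 * n)" using Output(4)[of \<psi> k] Output(4)[of \<phi> l] by auto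
    then show "cinner (bob_part n e \<psi>) (bob_part n e \<phi>) = 0"
      by (auto simp: bob_part_zero cinner_zero_left cinner_zero_right)
  qed
  moreover have "onb (unit_vec 2 0) (unit_vec 2 1)" by (simp add: onb_def cinner_unit_vec)
  ultimately show ?case by blast
next
  case (Measure p bs)
  note wf = Measure.prems(1) and S = Measure.prems(3) and correct = Measure.prems(4)
  have c: "\<And>b. b \<in> set bs \<Longrightarrow> fst b \<in> carrier_mat (local_dim n p) (local_dim n p)"
    and wfb: "\<And>b. b \<in> set bs \<Longrightarrow> wf_protocol n (snd b)"
    using wf by auto
  have correct_b: "correct_on n (snd b) (lift n p (fst b) *\<^sub>v \<psi>) k"
    if "b \<in> set bs" "\<psi> \<in> S k" for b \<psi> k
    using correct[OF that(2)] that(1) by simp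
  show ?case
  proof (cases "\<exists>b \<in> set bs. \<not> trivial_op (fst b)")
    case True
    then obtain b where b: "b \<in> set bs" "\<not> trivial_op (fst b)" by blast
    have p: "p = Alice" using Measure.prems(2) True by simp
    show ?thesis
    proof (rule nontrivial_outcome_separates[OF _ b(2) S])
      show "fst b \<in> carrier_mat 2 2" using c[OF b(1)] p by simp
      fix k l \<psi> \<phi> assume kl: "k \<noteq> l" "\<psi> \<in> S k" "\<phi> \<in> S l"
      then have \<psi>: "\<psi> \<in> carrier_vec (2 * n)" and \<phi>: "\<phi> \<in> carrier_vec (2 * n)" using S by blast+
      show "cinner \<psi> \<phi> = 0"
        using correct_on_orthogonal[OF wf \<psi> \<phi> correct[OF kl(2)] correct[OF kl(3)] kl(1)] .
      show "cinner (lift n Alice (fst b) *\<^sub>v \<psi>) (lift n Alice (fst b) *\<^sub>v \<phi>) = 0"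
        using correct_on_orthogonal[OF wfb[OF b(1)] _ _ correct_b[OF b(1) kl(2)]
            correct_b[OF b(1) kl(3)] kl(1)] c[OF b(1)] p by simp
    qed
  next
    case False
    then obtain b a where b: "b \<in> set bs" and a: "a \<noteq> 0"
      "adj (fst b) * fst b = a \<cdot>\<^sub>m 1\<^sub>m (local_dim n p)"
      using trivial_measurement_has_nonzero_outcome[OF wf n] by blast
    have af: "alice_first (snd b)" using Measure.prems(2) False b by simp
    \<comment> \<open>The subprotocol is correct on the images of the sets under the chosen
      operator, so these images form the new family.\<close>
    have "\<exists>e0 e1. onb e0 e1 \<and> separates n e0 (\<lambda>k. (*\<^sub>v) (lift n p (fst b)) ` S k) \<and>
        separates n e1 (\<lambda>k. (*\<^sub>v) (lift n p (fst b)) ` S k)"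
      by (rule Measure.IH[OF b wfb[OF b] af]) (use c[OF b] correct_b[OF b] in auto)
    then obtain e0 e1 where e: "onb e0 e1" "separates n e0 (\<lambda>k. (*\<^sub>v) (lift n p (fst b)) ` S k)"
      "separates n e1 (\<lambda>k. (*\<^sub>v) (lift n p (fst b)) ` S k)" by blast
    show ?thesis
    proof (cases p)
      case Alice
      show ?thesis
        by (rule trivial_outcome_pull_back_Alice[of "fst b" a S n e0 e1])
          (use Alice c[OF b] a S e in auto)
    next
      case Bob
      have "separates n x S" if "separates n x (\<lambda>k. (*\<^sub>v) (lift n p (fst b)) ` S k)" for x
        by (rule trivial_outcome_pull_back_Bob[of "fst b" n a S x])
          (use Bob c[OF b] a S that in auto)
      then show ?thesis using e by blast
    qed
  qed
qed

section \<open>Sufficiency\<close>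

definition projector :: "nat \<Rightarrow> complex mat \<Rightarrow> bool" where
  "projector d P \<longleftrightarrow> P \<in> carrier_mat d d \<and> adj P = P \<and> P * P = P"

lemma projector_vec:
  assumes "projector d P" "v \<in> carrier_vec d"
  shows "P *\<^sub>v (P *\<^sub>v v) = P *\<^sub>v v"
  using assms assoc_mult_mat_vec[of P d d P d v] by (auto simp: projector_def)

lemma projector_cinner:
  assumes "projector d P" "u \<in> carrier_vec d" "v \<in> carrier_vec d"
  shows "cinner (P *\<^sub>v u) v = cinner u (P *\<^sub>v v)"
  using assms cinner_adj_left[of P d d u v] by (auto simp: projector_def)

definition outer :: "nat \<Rightarrow> complex vec \<Rightarrow> complex mat" where
  "outer d u = mat d d (\<lambda>(i, j). u $ i * cnj (u $ j))"

lemma outer_carrier [simp]: "outer d u \<in> carrier_mat d d"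
  by (simp add: outer_def)

lemma adj_outer: "adj (outer d u) = outer d u"
  by (rule eq_matI) (auto simp: outer_def)

lemma outer_mult_vec:
  assumes "u \<in> carrier_vec d" "x \<in> carrier_vec d"
  shows "outer d u *\<^sub>v x = cinner u x \<cdot>\<^sub>v u"
  using assms by (intro eq_vecI)
    (auto simp: outer_def cinner_def scalar_prod_def atLeast0LessThan sum_distrib_left
      sum_distrib_right mult_ac intro!: sum.cong)

lemma projector_outer:
  assumes u: "u \<in> carrier_vec d" "cinner u u = 1"
  shows "projector d (outer d u)"
proof -
  have "outer d u * outer d u = outer d u"
  proof (rule eq_mat_by_mult_vec[of _ d d])
    fix v :: "complex vec" assume v: "v \<in> carrier_vec d"
    show "(outer d u * outer d u) *\<^sub>v v = outer d u *\<^sub>v v"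
      using u v by (subst assoc_mult_mat_vec[of _ d d _ d])
        (simp_all add: outer_mult_vec cinner_smult_right[of _ d])
  qed (auto intro: mult_carrier_mat[of _ d d])
  then show ?thesis by (simp add: projector_def adj_outer)
qed

text \<open>One Gram--Schmidt step: enlarging the range by \<open>x\<close> adds the rank-one projector onto the
  normalised component of \<open>x\<close> orthogonal to it.\<close>

lemma projector_extend:
  assumes P: "projector d P" and x: "x \<in> carrier_vec d"
  shows "\<exists>Q. projector d Q \<and> Q *\<^sub>v x = x \<and> (\<forall>v \<in> carrier_vec d. P *\<^sub>v v = v \<longrightarrow> Q *\<^sub>v v = v) \<and>
    (\<forall>v \<in> carrier_vec d. P *\<^sub>v v = 0\<^sub>v d \<longrightarrow> cinner x v = 0 \<longrightarrow> Q *\<^sub>v v = 0\<^sub>v d)"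
proof (cases "P *\<^sub>v x = x")
  case True
  then show ?thesis using P by blast
next
  case False
  have Pc: "P \<in> carrier_mat d d" and Pa: "adj P = P" and PP: "P * P = P"
    using P by (auto simp: projector_def)
  define w where "w = x - P *\<^sub>v x"
  have w: "w \<in> carrier_vec d" using x Pc by (simp add: w_def)
  have "w \<noteq> 0\<^sub>v d"
  proof
    assume "w = 0\<^sub>v d"
    then have "P *\<^sub>v x + w = P *\<^sub>v x" using x Pc by simp
    moreover have "P *\<^sub>v x + w = x" using x Pc by (auto simp: w_def)
    ultimately show False using False by simp
  qed
  then obtain c where c: "c \<noteq> 0" "cinner (c \<cdot>\<^sub>v w) (c \<cdot>\<^sub>v w) = 1"
    using exists_normalised_multiple[OF w] by blast
  define u where "u = c \<cdot>\<^sub>v w"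
  have u: "u \<in> carrier_vec d" "cinner u u = 1" using w c by (auto simp: u_def)
  have "P *\<^sub>v w = P *\<^sub>v x - P *\<^sub>v (P *\<^sub>v x)"
    unfolding w_def using x Pc by (intro mult_minus_distrib_mat_vec) auto
  then have "P *\<^sub>v w = 0\<^sub>v d" using projector_vec[OF P x] x Pc by simp
  then have Pu: "P *\<^sub>v u = 0\<^sub>v d" using w Pc by (auto simp: u_def mult_mat_vec)
  have uP: "cinner u (P *\<^sub>v v) = 0" if "v \<in> carrier_vec d" for v
    using projector_cinner[OF P u(1) that] Pu that by (simp add: cinner_zero_left)
  define Q where "Q = P + outer d u"
  have Qc: "Q \<in> carrier_mat d d" using Pc by (simp add: Q_def)
  have Qv: "Q *\<^sub>v v = P *\<^sub>v v + cinner u v \<cdot>\<^sub>v u" if "v \<in> carrier_vec d" for v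
    using that Pc u by (simp add: Q_def add_mult_distrib_mat_vec outer_mult_vec)
  have "Q * Q = Q"
  proof (rule eq_mat_by_mult_vec)
    fix v :: "complex vec" assume v: "v \<in> carrier_vec d"
    have Pv: "P *\<^sub>v v \<in> carrier_vec d" using Pc v by simp
    have "P *\<^sub>v (Q *\<^sub>v v) = P *\<^sub>v v"
      unfolding Qv[OF v]
      using mult_add_distrib_mat_vec[OF Pc Pv, of "cinner u v \<cdot>\<^sub>v u"] u mult_mat_vec[OF Pc u(1)]
        Pu projector_vec[OF P v] Pv by auto
    moreover have "cinner u (Q *\<^sub>v v) = cinner u v"
      using Qv[OF v] u uP[OF v] Pv
      by (simp add: cinner_add_right[of _ d] cinner_smult_right[of _ d])
    ultimately show "(Q * Q) *\<^sub>v v = Q *\<^sub>v v"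
      using Qv[OF v] Qv[OF mult_mat_vec_carrier[OF Qc v]] assoc_mult_mat_vec[OF Qc Qc v] by simp
  qed (use Qc in auto)
  moreover have "adj Q = Q" using Pc Pa by (simp add: Q_def adj_add[of _ d d] adj_outer)
  ultimately have Q: "projector d Q" using Qc by (simp add: projector_def)
  \<comment> \<open>As u is orthogonal to P x, the added projector sends x to <u, w> u. This equals
    (c <u, w>) w = <u, u> w = w, exactly the part of x that \<open>P\<close> misses.\<close>
  have xw: "P *\<^sub>v x + w = x" using x Pc by (auto simp: w_def)
  have "cinner u x = cinner u (P *\<^sub>v x) + cinner u w"
    using cinner_add_right[of u d "P *\<^sub>v x" w] xw u w Pc x by simp
  then have ux: "cinner u x = cinner u w" using uP[OF x] by simp
  have "c * cinner u w = 1" using u w cinner_smult_right[of u d w c] by (simp add: u_def)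
  moreover have "cinner u w \<cdot>\<^sub>v u = (c * cinner u w) \<cdot>\<^sub>v w"
    by (simp add: u_def smult_smult_assoc mult.commute)
  ultimately have "cinner u x \<cdot>\<^sub>v u = w" using w ux by simp
  then have "Q *\<^sub>v x = x" using Qv[OF x] xw by simp
  moreover have "Q *\<^sub>v v = v" if "v \<in> carrier_vec d" "P *\<^sub>v v = v" for v
    using Qv[OF that(1)] uP[OF that(1)] that u by auto
  moreover have "Q *\<^sub>v v = 0\<^sub>v d" if v: "v \<in> carrier_vec d" "P *\<^sub>v v = 0\<^sub>v d" "cinner x v = 0" for v
  proof -
    have "cinner x v = cinner (P *\<^sub>v x) v + cinner w v"
      using cinner_add_left[of "P *\<^sub>v x" d w v] xw w Pc x v by simp
    moreover have "cinner (P *\<^sub>v x) v = 0"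
      using projector_cinner[OF P x v(1)] v x by (simp add: cinner_zero_right)
    ultimately have "cinner u v = 0" using v w by (simp add: u_def cinner_smult_left[of _ d])
    then show ?thesis using Qv[OF v(1)] v u by auto
  qed
  ultimately show ?thesis using Q by blast
qed

text \<open>Fixing the vectors and killing their orthogonal complement characterises the orthogonal
  projector onto their span. The vectors may be linearly dependent, since
  \<open>projector_extend\<close> covers an \<open>x\<close> that \<open>P\<close> already
  fixes.\<close>

lemma projector_onto_list:
  assumes "set ws \<subseteq> carrier_vec d"
  shows "\<exists>P. projector d P \<and> (\<forall>w \<in> set ws. P *\<^sub>v w = w) \<and>
    (\<forall>v \<in> carrier_vec d. (\<forall>w \<in> set ws. cinner w v = 0) \<longrightarrow> P *\<^sub>v v = 0\<^sub>v d)"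
  using assms
proof (induction ws)
  case Nil
  have "adj (0\<^sub>m d d) = 0\<^sub>m d d" by (rule eq_matI) auto
  then have "projector d (0\<^sub>m d d)" by (simp add: projector_def)
  moreover have "0\<^sub>m d d *\<^sub>v v = 0\<^sub>v d" if "v \<in> carrier_vec d" for v :: "complex vec"
    using that by (intro eq_vecI) auto
  ultimately show ?case by auto
next
  case (Cons x ws)
  then obtain P where P: "projector d P" "\<forall>w \<in> set ws. P *\<^sub>v w = w"
    "\<forall>v \<in> carrier_vec d. (\<forall>w \<in> set ws. cinner w v = 0) \<longrightarrow> P *\<^sub>v v = 0\<^sub>v d" by auto
  have "x \<in> carrier_vec d" using Cons by simp
  from projector_extend[OF P(1) this] obtain Q where "projector d Q" "Q *\<^sub>v x = x"
    "\<forall>v \<in> carrier_vec d. P *\<^sub>v v = v \<longrightarrow> Q *\<^sub>v v = v"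
    "\<forall>v \<in> carrier_vec d. P *\<^sub>v v = 0\<^sub>v d \<longrightarrow> cinner x v = 0 \<longrightarrow> Q *\<^sub>v v = 0\<^sub>v d" by blast
  then show ?case using P Cons.prems by (intro exI[of _ Q]) auto
qed

text \<open>The range is spanned by the columns, and column j is the image of the j-th unit
  vector.\<close>

lemma projector_onto_range:
  assumes C: "C \<in> carrier_mat d m"
  shows "\<exists>P. projector d P \<and> P * C = C \<and>
    (\<forall>v \<in> carrier_vec d. (\<forall>x \<in> carrier_vec m. cinner (C *\<^sub>v x) v = 0) \<longrightarrow> P *\<^sub>v v = 0\<^sub>v d)"
proof -
  have "set (cols C) \<subseteq> carrier_vec d" using C cols_dim by blast
  from projector_onto_list[OF this] obtain P where P: "projector d P"
    "\<forall>w \<in> set (cols C). P *\<^sub>v w = w"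
    "\<forall>v \<in> carrier_vec d. (\<forall>w \<in> set (cols C). cinner w v = 0) \<longrightarrow> P *\<^sub>v v = 0\<^sub>v d" by blast
  have Pc: "P \<in> carrier_mat d d" using P by (simp add: projector_def)
  have col: "P *\<^sub>v col C j = col C j" if "j < m" for j using P(2) that C by (auto simp: cols_def)
  have "P * C = C"
  proof (rule eq_matI)
    fix i j assume ij: "i < dim_row C" "j < dim_col C"
    then have "(P * C) $$ (i, j) = (P *\<^sub>v col C j) $ i" using Pc C by simp
    also have "\<dots> = C $$ (i, j)" using col[of j] ij C by simp
    finally show "(P * C) $$ (i, j) = C $$ (i, j)" .
  qed (use Pc C in auto)
  moreover have "P *\<^sub>v v = 0\<^sub>v d"
    if v: "v \<in> carrier_vec d" "\<forall>x \<in> carrier_vec m. cinner (C *\<^sub>v x) v = 0" for v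
  proof -
    have "cinner (col C j) v = 0" if "j < m" for j
    proof -
      have "col C j = C *\<^sub>v unit_vec m j" using C that by (intro eq_vecI) auto
      then show ?thesis using v(2) by simp
    qed
    then show ?thesis using P(3) v(1) C by (auto simp: cols_def)
  qed
  ultimately show ?thesis using P(1) by blast
qed

text \<open>The second conjunct strengthens the induction: it says that the partial sum annihilates
  the next projector, which removes the cross terms of the square. For the full sum it shows that
  each range is fixed.\<close>

lemma projector_msum:
  assumes P: "\<And>k. k \<in> A \<Longrightarrow> projector d (P k)"
    and orth: "\<And>k l. k \<in> A \<Longrightarrow> l \<in> A \<Longrightarrow> k \<noteq> l \<Longrightarrow> P k * P l = 0\<^sub>m d d"
    and ks: "distinct ks" "set ks \<subseteq> A"
  shows "projector d (msum d (map P ks)) \<and>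
    (\<forall>l \<in> A. msum d (map P ks) * P l = (if l \<in> set ks then P l else 0\<^sub>m d d))"
  using ks
proof (induction ks)
  case Nil
  have "adj (0\<^sub>m d d) = 0\<^sub>m d d" by (rule eq_matI) auto
  moreover have "0\<^sub>m d d * P l = 0\<^sub>m d d" if "l \<in> A" for l
    using P[OF that] by (intro left_mult_zero_mat) (simp add: projector_def)
  ultimately show ?case by (simp add: projector_def)
next
  case (Cons k ks)
  define S where "S = msum d (map P ks)"
  have S: "projector d S" and SP: "\<And>l. l \<in> A \<Longrightarrow> S * P l = (if l \<in> set ks then P l else 0\<^sub>m d d)"
    using Cons by (auto simp: S_def)
  have k: "k \<in> A" "k \<notin> set ks" using Cons by auto
  have Sc: "S \<in> carrier_mat d d" "adj S = S" "S * S = S" using S by (auto simp: projector_def)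
  have Pc: "P l \<in> carrier_mat d d" "adj (P l) = P l" "P l * P l = P l" if "l \<in> A" for l
    using P[OF that] by (auto simp: projector_def)
  have SPk: "S * P k = 0\<^sub>m d d" using SP k by simp
  \<comment> \<open>The other cross term vanishes because both factors are self-adjoint.\<close>
  have "P k * S = adj (S * P k)" using adj_mult[OF Sc(1) Pc(1)[OF k(1)]] Sc Pc k by simp
  also have "\<dots> = 0\<^sub>m d d" unfolding SPk by (rule eq_matI) auto
  finally have PkS: "P k * S = 0\<^sub>m d d" .
  note c = Sc(1) Pc(1)[OF k(1)]
  have "(P k + S) * (P k + S) = P k + S"
    using c Sc Pc[OF k(1)] SPk PkS
    by (simp add: add_mult_distrib_mat[of _ d d] mult_add_distrib_mat[of _ d d])
  then have "projector d (P k + S)"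
    using c Sc Pc[OF k(1)] by (simp add: projector_def adj_add[of _ d d])
  moreover have "(P k + S) * P l = (if l \<in> set (k # ks) then P l else 0\<^sub>m d d)" if l: "l \<in> A" for l
  proof -
    have "(P k + S) * P l = P k * P l + S * P l"
      using c Pc(1)[OF l] by (simp add: add_mult_distrib_mat[of _ d d])
    then show ?thesis using SP[OF l] orth[OF k(1) l] Pc[OF l] k by (cases "l = k") auto
  qed
  ultimately show ?case by (simp add: S_def)
qed

text \<open>The extra operator \<open>R\<close> completes the measurement; its outcome never occurs.\<close>

lemma exists_discriminating_projectors:
  assumes C: "\<And>k. k \<in> {1..N} \<Longrightarrow> C k \<in> carrier_mat d m"
    and orth: "\<And>k l x y. k \<in> {1..N} \<Longrightarrow> l \<in> {1..N} \<Longrightarrow> k \<noteq> l \<Longrightarrow> x \<in> carrier_vec m \<Longrightarrow>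
      y \<in> carrier_vec m \<Longrightarrow> cinner (C k *\<^sub>v x) (C l *\<^sub>v y) = 0"
  shows "\<exists>P R. (\<forall>k \<in> {1..N}. projector d (P k)) \<and> projector d R \<and>
    R + msum d (map P [1..<Suc N]) = 1\<^sub>m d \<and>
    (\<forall>k \<in> {1..N}. \<forall>x \<in> carrier_vec m. R *\<^sub>v (C k *\<^sub>v x) = 0\<^sub>v d \<and>
      (\<forall>l \<in> {1..N}. l \<noteq> k \<longrightarrow> P l *\<^sub>v (C k *\<^sub>v x) = 0\<^sub>v d))"
proof -
  have "\<forall>k \<in> {1..N}. \<exists>P. projector d P \<and> P * C k = C k \<and>
    (\<forall>v \<in> carrier_vec d. (\<forall>x \<in> carrier_vec m. cinner (C k *\<^sub>v x) v = 0) \<longrightarrow> P *\<^sub>v v = 0\<^sub>v d)"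
    using projector_onto_range C by blast
  from bchoice[OF this] obtain P where P: "\<And>k. k \<in> {1..N} \<Longrightarrow> projector d (P k)"
    and PC: "\<And>k. k \<in> {1..N} \<Longrightarrow> P k * C k = C k"
    and kill: "\<And>k v. k \<in> {1..N} \<Longrightarrow> v \<in> carrier_vec d \<Longrightarrow>
      (\<And>x. x \<in> carrier_vec m \<Longrightarrow> cinner (C k *\<^sub>v x) v = 0) \<Longrightarrow> P k *\<^sub>v v = 0\<^sub>v d"
    by blast
  have Pc: "P k \<in> carrier_mat d d" if "k \<in> {1..N}" for k using P[OF that] by (simp add: projector_def)
  have Cx: "C k *\<^sub>v x \<in> carrier_vec d" if "k \<in> {1..N}" "x \<in> carrier_vec m" for k x
    using C[OF that(1)] that(2) by simp
  have PlC: "P l *\<^sub>v (C k *\<^sub>v x) = 0\<^sub>v d"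
    if "k \<in> {1..N}" "l \<in> {1..N}" "l \<noteq> k" "x \<in> carrier_vec m" for k l x
    using that Cx orth by (intro kill) auto
  \<comment> \<open>The range of \<open>P l\<close> is orthogonal to that of \<open>C k\<close>:
    moving \<open>P l\<close> across the inner product makes it act on
    \<open>C k *\<^sub>v x\<close>, which it kills. So \<open>P k\<close> kills the range of
    \<open>P l\<close>.\<close>
  have PP: "P k * P l = 0\<^sub>m d d" if kl: "k \<in> {1..N}" "l \<in> {1..N}" "k \<noteq> l" for k l
  proof (rule eq_mat_by_mult_vec[of _ d d])
    fix v :: "complex vec" assume v: "v \<in> carrier_vec d"
    have Plv: "P l *\<^sub>v v \<in> carrier_vec d" using Pc[OF kl(2)] v by simp
    have "P k *\<^sub>v (P l *\<^sub>v v) = 0\<^sub>v d"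
    proof (rule kill[OF kl(1) Plv])
      fix x :: "complex vec" assume x: "x \<in> carrier_vec m"
      show "cinner (C k *\<^sub>v x) (P l *\<^sub>v v) = 0"
        using projector_cinner[OF P[OF kl(2)] Cx[OF kl(1) x] v] PlC[OF kl(1,2) _ x] kl v
        by (simp add: cinner_zero_left)
    qed
    moreover have "0\<^sub>m d d *\<^sub>v v = 0\<^sub>v d" using v by (intro eq_vecI) auto
    ultimately show "(P k * P l) *\<^sub>v v = 0\<^sub>m d d *\<^sub>v v"
      using assoc_mult_mat_vec[OF Pc[OF kl(1)] Pc[OF kl(2)] v] by simp
  qed (use Pc kl in \<open>auto intro: mult_carrier_mat[of _ d d]\<close>)
  define S where "S = msum d (map P [1..<Suc N])"
  have "projector d S \<and> (\<forall>l \<in> {1..N}. S * P l = (if l \<in> set [1..<Suc N] then P l else 0\<^sub>m d d))"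
    unfolding S_def by (rule projector_msum[of "{1..N}"]) (use P PP in auto)
  then have S: "S \<in> carrier_mat d d" "adj S = S" "S * S = S"
    and SP: "\<And>l. l \<in> {1..N} \<Longrightarrow> S * P l = P l"
    by (auto simp: projector_def)
  define R where "R = 1\<^sub>m d - S"
  have Rc: "R \<in> carrier_mat d d" using S by (simp add: R_def minus_carrier_mat)
  have Rv: "R *\<^sub>v v = v - S *\<^sub>v v" if "v \<in> carrier_vec d" for v
    using minus_mult_distrib_mat_vec[OF one_carrier_mat S(1) that] that by (simp add: R_def)
  have "R * R = R"
  proof (rule eq_mat_by_mult_vec)
    fix v :: "complex vec" assume v: "v \<in> carrier_vec d"
    have Sv: "S *\<^sub>v v \<in> carrier_vec d" using S v by simp
    have "S *\<^sub>v (S *\<^sub>v v) = S *\<^sub>v v" using assoc_mult_mat_vec[OF S(1) S(1) v] S(3) by simp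
    then have "S *\<^sub>v (v - S *\<^sub>v v) = 0\<^sub>v d"
      using mult_minus_distrib_mat_vec[OF S(1) v Sv] Sv by simp
    then have "R *\<^sub>v (R *\<^sub>v v) = R *\<^sub>v v"
      using Rv[OF v] Rv[of "v - S *\<^sub>v v"] v Sv by auto
    then show "(R * R) *\<^sub>v v = R *\<^sub>v v" using assoc_mult_mat_vec[OF Rc Rc v] by simp
  qed (use Rc in auto)
  moreover have "adj R = R"
  proof (rule eq_matI)
    fix i j assume ij: "i < dim_row R" "j < dim_col R"
    then have "cnj (S $$ (j, i)) = S $$ (i, j)" using S Rc index_adj[of i S j] by simp
    then show "adj R $$ (i, j) = R $$ (i, j)" using ij S Rc by (auto simp: R_def)
  qed (use Rc in auto)
  ultimately have "projector d R" using Rc by (simp add: projector_def)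
  moreover have "R + msum d (map P [1..<Suc N]) = 1\<^sub>m d"
    unfolding S_def[symmetric] R_def using S by (intro eq_matI) auto
  moreover have "R *\<^sub>v (C k *\<^sub>v x) = 0\<^sub>v d" if k: "k \<in> {1..N}" and x: "x \<in> carrier_vec m" for k x
  proof -
    have Pk: "P k *\<^sub>v (C k *\<^sub>v x) = C k *\<^sub>v x"
      using assoc_mult_mat_vec[OF Pc[OF k] C[OF k] x] PC[OF k] by simp
    \<comment> \<open>Insert \<open>P k\<close>, which fixes the vector, and absorb \<open>S\<close>
      by \<open>S * P k = P k\<close>.\<close>
    have "S *\<^sub>v (C k *\<^sub>v x) = C k *\<^sub>v x"
      using assoc_mult_mat_vec[OF S(1) Pc[OF k] Cx[OF k x]] SP[OF k] Pk by simp
    then show ?thesis using Rv[OF Cx[OF k x]] Cx[OF k x] by simp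
  qed
  ultimately show ?thesis using P PlC by (intro exI[of _ P] exI[of _ R]) auto
qed

text \<open>The operator <e| \<otimes> I as a matrix. With it, Bob's components of a whole support
  form the range of one matrix, \<open>bob_mat n e * \<rho> k\<close>, as
  \<open>exists_discriminating_projectors\<close> expects.\<close>

definition bob_mat :: "nat \<Rightarrow> complex vec \<Rightarrow> complex mat" where
  "bob_mat n e = mat n (2 * n) (\<lambda>(b, i). if i mod n = b then cnj (e $ (i div n)) else 0)"

lemma bob_mat_carrier [simp]: "bob_mat n e \<in> carrier_mat n (2 * n)"
  by (simp add: bob_mat_def)

lemma bob_mat_mult_vec:
  assumes "\<psi> \<in> carrier_vec (2 * n)"
  shows "bob_mat n e *\<^sub>v \<psi> = bob_part n e \<psi>"
proof (rule eq_vecI)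
  fix b assume "b < dim_vec (bob_part n e \<psi>)"
  then have b: "b < n" by simp
  have "(bob_mat n e *\<^sub>v \<psi>) $ b = (\<Sum>i<2 * n. bob_mat n e $$ (b, i) * \<psi> $ i)"
    using assms b by (intro index_mult_mat_vec_sum) auto
  also have "\<dots> = (\<Sum>a<2. \<Sum>b'<n. bob_mat n e $$ (b, a * n + b') * \<psi> $ (a * n + b'))"
    by (rule sum_joint)
  also have "\<dots> = (\<Sum>a<2. \<Sum>b'<n. if b' = b then cnj (e $ a) * \<psi> $ (a * n + b') else 0)"
    using b joint_index by (intro sum.cong refl) (auto simp: bob_mat_def)
  also have "\<dots> = bob_part n e \<psi> $ b" using b by (simp add: bob_part_index)
  finally show "(bob_mat n e *\<^sub>v \<psi>) $ b = bob_part n e \<psi> $ b" .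
qed (simp add: bob_mat_def)

text \<open>After the outcome \<open>e\<close> the joint state is a product vector, so all remaining
  information about the index lies in Bob's factor.\<close>

lemma lift_Alice_outer:
  assumes "e \<in> carrier_vec 2" "\<psi> \<in> carrier_vec (2 * n)"
  shows "lift n Alice (outer 2 e) *\<^sub>v \<psi> = tensor_vec n e (bob_part n e \<psi>)"
proof (rule joint_vec_eqI)
  fix a b :: nat assume ab: "a < 2" "b < n"
  then show "(lift n Alice (outer 2 e) *\<^sub>v \<psi>) $ (a * n + b)
      = tensor_vec n e (bob_part n e \<psi>) $ (a * n + b)"
    using assms by (simp add: lift_Alice_index tensor_vec_index bob_part_index outer_def
        sum_distrib_left mult.assoc del: index_mult_mat_vec)
qed auto

lemma exists_bob_protocol:
  assumes \<rho>: "\<forall>k \<in> {1..N}. density_op (2 * n) (\<rho> k)" and e: "e \<in> carrier_vec 2"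
    and sep: "\<And>k l \<psi> \<phi>. k \<in> {1..N} \<Longrightarrow> l \<in> {1..N} \<Longrightarrow> k \<noteq> l \<Longrightarrow> \<psi> \<in> Supp (\<rho> k) \<Longrightarrow>
      \<phi> \<in> Supp (\<rho> l) \<Longrightarrow> cinner (bob_part n e \<psi>) (bob_part n e \<phi>) = 0"
  shows "\<exists>Q. wf_protocol n Q \<and> (\<forall>k \<in> {1..N}. \<forall>\<psi> \<in> Supp (\<rho> k).
    correct_on n Q (lift n Alice (outer 2 e) *\<^sub>v \<psi>) k)"
proof -
  have c: "\<rho> k \<in> carrier_mat (2 * n) (2 * n)" if "k \<in> {1..N}" for k
    using \<rho> that by (simp add: density_op_def)
  have supp: "Supp (\<rho> k) = {\<rho> k *\<^sub>v v | v. v \<in> carrier_vec (2 * n)}" if "k \<in> {1..N}" for k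
    using psd_Supp_eq_range[OF density_op_psd] \<rho> that by blast
  define C where "C k = bob_mat n e * \<rho> k" for k
  have C: "C k \<in> carrier_mat n (2 * n)" if "k \<in> {1..N}" for k
    using c[OF that] by (simp add: C_def mult_carrier_mat[of _ n "2 * n"])
  have Cv: "C k *\<^sub>v v = bob_part n e (\<rho> k *\<^sub>v v)" if "k \<in> {1..N}" "v \<in> carrier_vec (2 * n)" for k v
    unfolding C_def assoc_mult_mat_vec[OF bob_mat_carrier c[OF that(1)] that(2)]
    using c[OF that(1)] that(2) by (simp add: bob_mat_mult_vec)
  have "\<exists>P R. (\<forall>k \<in> {1..N}. projector n (P k)) \<and> projector n R \<and>
    R + msum n (map P [1..<Suc N]) = 1\<^sub>m n \<and>
    (\<forall>k \<in> {1..N}. \<forall>x \<in> carrier_vec (2 * n). R *\<^sub>v (C k *\<^sub>v x) = 0\<^sub>v n \<and>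
      (\<forall>l \<in> {1..N}. l \<noteq> k \<longrightarrow> P l *\<^sub>v (C k *\<^sub>v x) = 0\<^sub>v n))"
  proof (rule exists_discriminating_projectors[OF C])
    fix k l and x y :: "complex vec" assume kl: "k \<in> {1..N}" "l \<in> {1..N}" "k \<noteq> l"
      and xy: "x \<in> carrier_vec (2 * n)" "y \<in> carrier_vec (2 * n)"
    then have "\<rho> k *\<^sub>v x \<in> Supp (\<rho> k)" "\<rho> l *\<^sub>v y \<in> Supp (\<rho> l)" using supp by blast+
    from sep[OF kl this] show "cinner (C k *\<^sub>v x) (C l *\<^sub>v y) = 0" using Cv kl xy by simp
  qed
  then obtain P R where P: "\<And>k. k \<in> {1..N} \<Longrightarrow> projector n (P k)" and R: "projector n R"
    and sum: "R + msum n (map P [1..<Suc N]) = 1\<^sub>m n"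
    and RC: "\<And>k x. k \<in> {1..N} \<Longrightarrow> x \<in> carrier_vec (2 * n) \<Longrightarrow> R *\<^sub>v (C k *\<^sub>v x) = 0\<^sub>v n"
    and PC: "\<And>k l x. k \<in> {1..N} \<Longrightarrow> x \<in> carrier_vec (2 * n) \<Longrightarrow> l \<in> {1..N} \<Longrightarrow> l \<noteq> k \<Longrightarrow>
      P l *\<^sub>v (C k *\<^sub>v x) = 0\<^sub>v n" by blast
  \<comment> \<open>The label 0 lies outside the range of indices. It is harmless, because
    \<open>R\<close> annihilates Bob's component of every support vector.\<close>
  define bs where "bs = (R, Output 0) # map (\<lambda>k. (P k, Output k)) [1..<Suc N]"
  define Q where "Q = Measure Bob bs"
  have bs: "projector n (fst b) \<and> wf_protocol n (snd b)" if "b \<in> set bs" for b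
    using that P R by (auto simp: bs_def)
  have "map (\<lambda>b. adj (fst b) * fst b) bs = map fst bs"
    using bs by (auto simp: projector_def)
  also have "\<dots> = R # map P [1..<Suc N]" by (simp add: bs_def o_def del: upt_Suc)
  finally have "msum n (map (\<lambda>b. adj (fst b) * fst b) bs) = 1\<^sub>m n" using sum by simp
  then have "wf_protocol n Q"
    using bs by (auto simp: Q_def projector_def) (simp add: bs_def)
  moreover have "correct_on n Q (lift n Alice (outer 2 e) *\<^sub>v \<psi>) k"
    if k: "k \<in> {1..N}" and \<psi>: "\<psi> \<in> Supp (\<rho> k)" for k \<psi>
  proof -
    obtain v where v: "v \<in> carrier_vec (2 * n)" "\<psi> = \<rho> k *\<^sub>v v" using \<psi> supp[OF k] by blast
    then have \<psi>c: "\<psi> \<in> carrier_vec (2 * n)" using c[OF k] by simp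
    have CB: "C k *\<^sub>v v = bob_part n e \<psi>" using Cv[OF k v(1)] v by simp
    \<comment> \<open>An operator that kills Bob's component kills the whole product vector. This
      covers every leaf whose label differs from \<open>k\<close>.\<close>
    have "lift n Bob M *\<^sub>v (lift n Alice (outer 2 e) *\<^sub>v \<psi>) = 0\<^sub>v (2 * n)"
      if "projector n M" "M *\<^sub>v (C k *\<^sub>v v) = 0\<^sub>v n" for M
      using that e \<psi>c unfolding CB
      by (simp add: lift_Alice_outer lift_Bob_tensor_vec projector_def tensor_vec_zero)
    then show ?thesis using R P RC[OF k v(1)] PC[OF k v(1)] by (auto simp: Q_def bs_def)
  qed
  ultimately show ?thesis by blast
qed

text \<open>A rank-one projector on the qubit is not scalar: a scalar c would have to be 0 because
  of \<open>e1\<close> and 1 because of \<open>e0\<close>.\<close>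

lemma outer_nontrivial:
  assumes "onb e0 e1"
  shows "\<not> trivial_op (outer 2 e0)"
proof
  have e: "e0 \<in> carrier_vec 2" "e1 \<in> carrier_vec 2"
    "cinner e0 e0 = 1" "cinner e1 e1 = 1" "cinner e0 e1 = 0"
    using assms by (auto simp: onb_def)
  assume "trivial_op (outer 2 e0)"
  then obtain c where "adj (outer 2 e0) * outer 2 e0 = c \<cdot>\<^sub>m 1\<^sub>m 2"
    by (auto simp: trivial_op_def outer_def)
  then have c: "outer 2 e0 = c \<cdot>\<^sub>m 1\<^sub>m 2"
    using projector_outer[OF e(1,3)] by (simp add: projector_def)
  have x: "cinner e0 x \<cdot>\<^sub>v e0 = c \<cdot>\<^sub>v x" if "x \<in> carrier_vec 2" for x
    using outer_mult_vec[OF e(1) that] scalar_mat_mult_vec[OF that, of c] c by simp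
  have "cinner e1 (cinner e0 e1 \<cdot>\<^sub>v e0) = cinner e1 (c \<cdot>\<^sub>v e1)" using x[OF e(2)] by simp
  then have "c = 0" using e by (simp add: cinner_smult_right[of _ 2])
  moreover have "cinner e0 (cinner e0 e0 \<cdot>\<^sub>v e0) = cinner e0 (c \<cdot>\<^sub>v e0)" using x[OF e(1)] by simp
  ultimately show False using e by (simp add: cinner_smult_right[of _ 2])
qed

lemma onb_outer_sum:
  assumes "onb e0 e1"
  shows "outer 2 e0 + outer 2 e1 = 1\<^sub>m 2"
  using onb_completeness[OF assms] by (intro eq_matI) (auto simp: outer_def)

theorem theorem1:
  fixes n N :: nat and \<rho> :: "nat \<Rightarrow> complex mat"
  assumes "n \<ge> 1"
    and "\<forall>k \<in> {1..N}. density_op (2 * n) (\<rho> k)"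
    and "\<forall>k \<in> {1..N}. \<forall>l \<in> {1..N}. k \<noteq> l \<longrightarrow> tr (\<rho> k * \<rho> l) = 0"
  shows "(\<exists>P. wf_protocol n P \<and> alice_first P \<and> perfectly_discriminates n P N \<rho>) \<longleftrightarrow>
    (\<exists>e0 e1. e0 \<in> carrier_vec 2 \<and> e1 \<in> carrier_vec 2 \<and>
       cinner e0 e0 = 1 \<and> cinner e1 e1 = 1 \<and> cinner e0 e1 = 0 \<and>
       (\<forall>k \<in> {1..N}. \<forall>l \<in> {1..N}. k \<noteq> l \<longrightarrow>
          (\<forall>\<psi>k \<in> Supp (\<rho> k). \<forall>\<psi>l \<in> Supp (\<rho> l).
             cinner (bob_part n e0 \<psi>k) (bob_part n e0 \<psi>l) = 0 \<and>
             cinner (bob_part n e1 \<psi>k) (bob_part n e1 \<psi>l) = 0)))"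
    (is "?protocol \<longleftrightarrow> (\<exists>e0 e1. ?basis e0 e1)")
proof
  have supp: "Supp (\<rho> k) \<subseteq> carrier_vec (2 * n)" if "k \<in> {1..N}" for k
    using Supp_subset_range[of "\<rho> k" "2 * n"] assms(2) that
    by (metis density_op_def mult_mat_vec_carrier subsetI)
  {
    assume ?protocol
    then obtain P where P: "wf_protocol n P" "alice_first P" "perfectly_discriminates n P N \<rho>"
      by blast
    \<comment> \<open>\<open>separates\<close> ranges over all naturals, so indices without a state
      get the empty set.\<close>
    define S where "S k = (if k \<in> {1..N} then Supp (\<rho> k) else {})" for k
    have "\<exists>e0 e1. onb e0 e1 \<and> separates n e0 S \<and> separates n e1 S"
      by (rule alice_first_separates[OF assms(1) P(1,2)])
        (use supp P(3) perfectly_discriminates_iff[OF assms(2) P(1)] in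
          \<open>auto simp: S_def split: if_splits\<close>)
    then obtain e0 e1 where e: "onb e0 e1" "separates n e0 S" "separates n e1 S" by blast
    show "\<exists>e0 e1. ?basis e0 e1"
      by (rule exI[of _ e0], rule exI[of _ e1])
        (use e in \<open>auto simp: onb_def separates_def S_def\<close>)
  next
    assume "\<exists>e0 e1. ?basis e0 e1"
    then obtain e0 e1 where basis: "?basis e0 e1" by (elim exE) (rule that)
    then have onb: "onb e0 e1" unfolding onb_def by (elim conjE) (intro conjI)
    have sep: "\<And>k l \<psi> \<phi>. k \<in> {1..N} \<Longrightarrow> l \<in> {1..N} \<Longrightarrow> k \<noteq> l \<Longrightarrow> \<psi> \<in> Supp (\<rho> k) \<Longrightarrow>
        \<phi> \<in> Supp (\<rho> l) \<Longrightarrow> cinner (bob_part n e0 \<psi>) (bob_part n e0 \<phi>) = 0 \<and>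
          cinner (bob_part n e1 \<psi>) (bob_part n e1 \<phi>) = 0"
      using basis by (elim conjE) blast
    have e: "e0 \<in> carrier_vec 2" "e1 \<in> carrier_vec 2" "cinner e0 e0 = 1" "cinner e1 e1 = 1"
      using onb by (auto simp: onb_def)
    obtain Q0 where Q0: "wf_protocol n Q0" "\<And>k \<psi>. k \<in> {1..N} \<Longrightarrow> \<psi> \<in> Supp (\<rho> k) \<Longrightarrow>
        correct_on n Q0 (lift n Alice (outer 2 e0) *\<^sub>v \<psi>) k"
      using exists_bob_protocol[OF assms(2) e(1)] sep by blast
    obtain Q1 where Q1: "wf_protocol n Q1" "\<And>k \<psi>. k \<in> {1..N} \<Longrightarrow> \<psi> \<in> Supp (\<rho> k) \<Longrightarrow>
        correct_on n Q1 (lift n Alice (outer 2 e1) *\<^sub>v \<psi>) k"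
      using exists_bob_protocol[OF assms(2) e(2)] sep by blast
    define P where "P = Measure Alice [(outer 2 e0, Q0), (outer 2 e1, Q1)]"
    have "outer 2 e0 + (outer 2 e1 + 0\<^sub>m 2 2) = 1\<^sub>m 2" using onb_outer_sum[OF onb] by simp
    then have wf: "wf_protocol n P"
      using Q0 Q1 projector_outer[OF e(1,3)] projector_outer[OF e(2,4)]
      by (simp add: P_def projector_def)
    \<comment> \<open>The root already contains a non-trivial operator of Alice, which decides the
      matter; Bob's later measurements are unrestricted.\<close>
    moreover have "alice_first P" using outer_nontrivial[OF onb] by (simp add: P_def)
    moreover have "perfectly_discriminates n P N \<rho>"
      unfolding perfectly_discriminates_iff[OF assms(2) wf] using Q0 Q1 by (simp add: P_def)
    ultimately show ?protocol by blast
  }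
qed

end
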